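(* Let $\mathcal H$ be an infinite-dimensional Hilbert space and let $\mathcal D_+^k$ be the set of $k$-tuples of positive invertible bounded operators on $\mathcal H$. Define maps $G_k$ on $\mathcal D_+^k$, $k=1,2,\dots$, recursively by $G_1(A)=A$ and \[ G_{k+1}(A_1,\dots,A_{k+1})=A_{k+1}^{1/2}\,G_k\bigl(A_{k+1}^{-1/2}A_1A_{k+1}^{-1/2},\dots,A_{k+1}^{-1/2}A_kA_{k+1}^{-1/2}\bigr)^{k/(k+1)}A_{k+1}^{1/2}. \] Then for every $k=1,2,\dots$: (i) $G_k$ is increasing in each variable (with respect to the operator order). (ii) $G_k$ is congruence invariant: for any invertible bounded operator $C$ on $\mathcal H$, \[ G_k(C^*A_1C,\dots,C^*A_kC)=C^*G_k(A_1,\dots,A_k)C,\qquad (A_1,\dots,A_k)\in\mathcal D_+^k. \] (iii) $G_k$ is jointly homogeneous: \[ G_k(t_1A_1,\dots,t_kA_k)=(t_1\cdots t_k)^{1/k}G_k(A_1,\dots,A_k) \] for scalars $t_1,\dots,t_k>0$ and $(A_1,\dots,A_k)\in\mathcal D_+^k$. (iv) $G_k$ is self-dual: $G_k(A_1^{-1},\dots,A_k^{-1})=G_k(A_1,\dots,A_k)^{-1}$ for $(A_1,\dots,A_k)\in\mathcal D_+^k$. (v) When restricted to positive definite matrices, $\det G_k(A_1,\dots,A_k)=(\det A_1\cdots\det A_k)^{1/k}$.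
   Context: The operator order is the usual Loewner order: $A\le B$ means $B-A$ is positive semi-definite. Powers are defined by the functional calculus. In (v), $G_k$ for positive definite (invertible) $n\times n$ matrices $A_1,\dots,A_k$ is given by the same recursive formula applied to matrices. *)

theory Defs
  imports "HOL-Analysis.Analysis" "HOL-Computational_Algebra.Polynomial"
begin

class complex_hilbert = banach +
  fixes scaleC :: "complex \<Rightarrow> 'a \<Rightarrow> 'a"  (infixr "*\<^sub>C" 75)
    and cinner :: "'a \<Rightarrow> 'a \<Rightarrow> complex"
  assumes scaleC_add_right: "c *\<^sub>C (x + y) = c *\<^sub>C x + c *\<^sub>C y"
    and scaleC_add_left: "(b + c) *\<^sub>C x = b *\<^sub>C x + c *\<^sub>C x"
    and scaleC_scaleC: "b *\<^sub>C c *\<^sub>C x = (b * c) *\<^sub>C x"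
    and scaleC_one: "1 *\<^sub>C x = x"
    and scaleR_scaleC: "r *\<^sub>R x = complex_of_real r *\<^sub>C x"
    and cinner_commute: "cinner x y = cnj (cinner y x)"
    and cinner_add_right: "cinner x (y + z) = cinner x y + cinner x z"
    and cinner_scaleC_right: "cinner x (c *\<^sub>C y) = c * cinner x y"
    and cinner_ge_zero: "cinner x x \<in> \<real>\<^sub>\<ge>\<^sub>0"
    and cinner_eq_zero_iff: "cinner x x = 0 \<longleftrightarrow> x = 0"
    and norm_eq_sqrt_cinner: "norm x = sqrt (Re (cinner x x))"

instantiation complex :: complex_hilbert
begin

definition "scaleC c (x :: complex) = c * x"

definition "cinner x (y :: complex) = cnj x * y"

instance
proof
  fix x :: complex
  have *: "cnj x * x = complex_of_real ((cmod x)\<^sup>2)"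
    by (metis complex_norm_square mult.commute)
  show "cinner x x \<in> \<real>\<^sub>\<ge>\<^sub>0" "norm x = sqrt (Re (cinner x x))"
    unfolding cinner_complex_def * by auto
qed (auto simp: scaleC_complex_def cinner_complex_def algebra_simps scaleR_conv_of_real)

end

text \<open>The norm on \<open>'a ^ 'n\<close> in the library is the Euclidean one, so \<open>complex ^ 'n\<close> becomes
  the usual \<open>n\<close>-dimensional complex Hilbert space.\<close>

instantiation vec :: (complex_hilbert, finite) complex_hilbert
begin

definition "scaleC c (x :: 'a ^ 'b) = (\<chi> i. c *\<^sub>C (x $ i))"

definition "cinner x (y :: 'a ^ 'b) = (\<Sum>i\<in>UNIV. cinner (x $ i) (y $ i))"

instance
proof
  fix x y z :: "'a ^ 'b" and b c :: complex and r :: real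
  show "c *\<^sub>C (x + y) = c *\<^sub>C x + c *\<^sub>C y" "(b + c) *\<^sub>C x = b *\<^sub>C x + c *\<^sub>C x"
    "b *\<^sub>C c *\<^sub>C x = (b * c) *\<^sub>C x" "1 *\<^sub>C x = x" "r *\<^sub>R x = complex_of_real r *\<^sub>C x"
    by (auto simp: scaleC_vec_def vec_eq_iff scaleC_add_right scaleC_add_left scaleC_scaleC
        scaleC_one scaleR_scaleC)
  show "cinner x y = cnj (cinner y x)"
    unfolding cinner_vec_def cnj_sum by (rule sum.cong[OF refl], rule cinner_commute)
  show "cinner x (y + z) = cinner x y + cinner x z" "cinner x (c *\<^sub>C y) = c * cinner x y"
    by (simp_all add: cinner_vec_def scaleC_vec_def cinner_add_right cinner_scaleC_right
        sum.distrib sum_distrib_left)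
  have *: "cinner u u = complex_of_real ((norm u)\<^sup>2)" for u :: 'a
    using cinner_ge_zero[of u] norm_eq_sqrt_cinner[of u]
    by (auto simp: complex_nonneg_Reals_iff complex_eq_iff)
  have **: "cinner x x = complex_of_real (\<Sum>i\<in>UNIV. (norm (x $ i))\<^sup>2)"
    by (simp add: cinner_vec_def *)
  show "cinner x x \<in> \<real>\<^sub>\<ge>\<^sub>0"
    unfolding ** nonneg_Reals_of_real_iff by (simp add: sum_nonneg)
  show "norm x = sqrt (Re (cinner x x))"
    unfolding ** norm_vec_def L2_set_def Re_complex_of_real ..
  show "cinner x x = 0 \<longleftrightarrow> x = 0"
    unfolding ** of_real_eq_0_iff by (simp add: sum_nonneg_eq_0_iff vec_eq_iff)
qed

end

definition infinite_dimensional :: "'a :: complex_hilbert itself \<Rightarrow> bool" where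
  "infinite_dimensional _ \<longleftrightarrow>
    \<not> (\<exists>B :: 'a set. finite B \<and> module.span scaleC B = UNIV)"

text \<open>The elements of \<open>'a \<Rightarrow>\<^sub>L 'a\<close> are the bounded real-linear maps; \<open>clinear_op\<close> singles out
  the bounded operators of the complex Hilbert space.\<close>

definition clinear_op :: "('a :: complex_hilbert \<Rightarrow>\<^sub>L 'a) \<Rightarrow> bool" where
  "clinear_op A \<longleftrightarrow> (\<forall>c x. blinfun_apply A (c *\<^sub>C x) = c *\<^sub>C blinfun_apply A x)"

definition op_invertible :: "('a :: complex_hilbert \<Rightarrow>\<^sub>L 'a) \<Rightarrow> bool" where
  "op_invertible A \<longleftrightarrow> clinear_op A \<and>
    (\<exists>B. clinear_op B \<and> A o\<^sub>L B = id_blinfun \<and> B o\<^sub>L A = id_blinfun)"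

definition op_inverse :: "('a :: complex_hilbert \<Rightarrow>\<^sub>L 'a) \<Rightarrow> ('a \<Rightarrow>\<^sub>L 'a)" where
  "op_inverse A = (THE B. A o\<^sub>L B = id_blinfun \<and> B o\<^sub>L A = id_blinfun)"

definition op_adjoint :: "('a :: complex_hilbert \<Rightarrow>\<^sub>L 'a) \<Rightarrow> ('a \<Rightarrow>\<^sub>L 'a)" where
  "op_adjoint A = (THE B. \<forall>x y. cinner (blinfun_apply A x) y = cinner x (blinfun_apply B y))"

definition op_positive :: "('a :: complex_hilbert \<Rightarrow>\<^sub>L 'a) \<Rightarrow> bool" where
  "op_positive A \<longleftrightarrow> clinear_op A \<and> (\<forall>x. cinner x (blinfun_apply A x) \<in> \<real>\<^sub>\<ge>\<^sub>0)"

definition loewner_le :: "('a :: complex_hilbert \<Rightarrow>\<^sub>L 'a) \<Rightarrow> ('a \<Rightarrow>\<^sub>L 'a) \<Rightarrow> bool"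
    (infix "\<le>\<^sub>L" 50) where
  "A \<le>\<^sub>L B \<longleftrightarrow> op_positive (B - A)"

definition pos_invertible_ops :: "('a :: complex_hilbert \<Rightarrow>\<^sub>L 'a) set" where
  "pos_invertible_ops = {A. op_positive A \<and> op_invertible A}"

definition scalar_op :: "complex \<Rightarrow> ('a :: complex_hilbert \<Rightarrow>\<^sub>L 'a)" where
  "scalar_op c = Blinfun (\<lambda>x. c *\<^sub>C x)"

definition op_spectrum :: "('a :: complex_hilbert \<Rightarrow>\<^sub>L 'a) \<Rightarrow> complex set" where
  "op_spectrum A = {z. \<not> op_invertible (A - scalar_op z)}"

definition op_poly :: "real poly \<Rightarrow> ('a :: complex_hilbert \<Rightarrow>\<^sub>L 'a) \<Rightarrow> ('a \<Rightarrow>\<^sub>L 'a)" where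
  "op_poly p A = (\<Sum>i\<le>degree p. coeff p i *\<^sub>R ((\<lambda>B. A o\<^sub>L B) ^^ i) id_blinfun)"

text \<open>Continuous functional calculus of a self-adjoint operator: \<open>f(A)\<close> is the norm limit of
  \<open>p\<^sub>n(A)\<close> for any polynomials \<open>p\<^sub>n\<close> converging to \<open>f\<close> uniformly on the spectrum of \<open>A\<close>. The
  spectrum is then real, so nothing is lost by testing convergence at its real points only.\<close>

definition op_fun_calc :: "(real \<Rightarrow> real) \<Rightarrow> ('a :: complex_hilbert \<Rightarrow>\<^sub>L 'a) \<Rightarrow> ('a \<Rightarrow>\<^sub>L 'a)" where
  "op_fun_calc f A = (THE B. \<forall>p :: nat \<Rightarrow> real poly.
     uniform_limit {x. complex_of_real x \<in> op_spectrum A} (\<lambda>n. poly (p n)) f sequentially \<longrightarrow>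
     (\<lambda>n. op_poly (p n) A) \<longlonglongrightarrow> B)"

definition op_powr :: "('a :: complex_hilbert \<Rightarrow>\<^sub>L 'a) \<Rightarrow> real \<Rightarrow> ('a \<Rightarrow>\<^sub>L 'a)" where
  "op_powr A r = op_fun_calc (\<lambda>x. x powr r) A"

text \<open>The functional calculus of a matrix is that of the operator it induces on \<open>complex ^ 'n\<close>.\<close>

definition matrix_powr :: "complex ^ 'n ^ 'n \<Rightarrow> real \<Rightarrow> complex ^ 'n ^ 'n" where
  "matrix_powr A r = matrix (blinfun_apply (op_powr (Blinfun (\<lambda>x. A *v x)) r))"

definition matrix_pos_def :: "complex ^ 'n ^ 'n \<Rightarrow> bool" where
  "matrix_pos_def A \<longleftrightarrow>
    (\<forall>x. x \<noteq> 0 \<longrightarrow> cinner x (A *v x) \<in> \<real> \<and> 0 < Re (cinner x (A *v x)))"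

text \<open>The recursion is parametrised by the multiplication and the real powers, so that it can be
  used both for operators and for matrices. A \<open>k\<close>-tuple is given by the values at \<open>1, \<dots>, k\<close>
  of a function on \<open>nat\<close>; only \<open>k \<ge> 1\<close> is meaningful.\<close>

primrec gmean_rec ::
  "('m \<Rightarrow> 'm \<Rightarrow> 'm) \<Rightarrow> ('m \<Rightarrow> real \<Rightarrow> 'm) \<Rightarrow> nat \<Rightarrow> (nat \<Rightarrow> 'm) \<Rightarrow> 'm" where
  "gmean_rec mul pw 0 A = undefined"
| "gmean_rec mul pw (Suc k) A =
    (if k = 0 then A 1
     else
       let S = pw (A (Suc k)) (1/2); T = pw (A (Suc k)) (- 1/2)
       in mul (mul S (pw (gmean_rec mul pw k (\<lambda>i. mul (mul T (A i)) T))
                         (real k / real (k + 1)))) S)"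

definition op_gmean :: "nat \<Rightarrow> (nat \<Rightarrow> ('a :: complex_hilbert \<Rightarrow>\<^sub>L 'a)) \<Rightarrow> ('a \<Rightarrow>\<^sub>L 'a)" where
  "op_gmean = gmean_rec (o\<^sub>L) op_powr"

definition matrix_gmean :: "nat \<Rightarrow> (nat \<Rightarrow> complex ^ 'n ^ 'n) \<Rightarrow> complex ^ 'n ^ 'n" where
  "matrix_gmean = gmean_rec (**) matrix_powr"

end

theory Submission
  imports Defs "HOL-Computational_Algebra.Fundamental_Theorem_Algebra"
begin

text \<open>
  The proof rests on one observation. If \<open>G\<^sub>k\<close> is congruence invariant, the congruence by
  \<open>A\<^bsub>k+1\<^esub>\<^bsup>-1/2\<^esup>\<close> inside the recursion can be pulled out of \<open>G\<^sub>k\<close>, and the recursion becomes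
  \<open>G\<^bsub>k+1\<^esub>(A\<^sub>1, \<dots>, A\<^bsub>k+1\<^esub>) = A\<^bsub>k+1\<^esub> #\<^sub>s G\<^sub>k(A\<^sub>1, \<dots>, A\<^sub>k)\<close> with \<open>s = k / (k + 1)\<close>, where
  \<open>A #\<^sub>s X = A\<^bsup>1/2\<^esup> (A\<^bsup>-1/2\<^esup> X A\<^bsup>-1/2\<^esup>)\<^sup>s A\<^bsup>1/2\<^esup>\<close> is the weighted geometric mean of two operators
  (\<open>op_gmean_Suc\<close>). Every property of \<open>G\<^sub>k\<close> then follows by induction on \<open>k\<close> from the corresponding
  property of the two-variable mean.

  For the two-variable mean, congruence invariance holds because \<open>A\<^bsup>1/2\<^esup> C (C\<^sup>* A C)\<^bsup>-1/2\<^esup>\<close> is a unitary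
  that intertwines the two operators whose \<open>s\<close>-th powers are taken (\<open>wmean_congruence\<close>). It implies the symmetry
  \<open>A #\<^sub>s X = X #\<^bsub>1-s\<^esub> A\<close> (\<open>wmean_swap\<close>), so that monotonicity in either variable reduces to the
  Loewner--Heinz inequality: \<open>A \<le> B\<close> implies \<open>A\<^sup>s \<le> B\<^sup>s\<close> for \<open>0 \<le> s \<le> 1\<close> (\<open>Loewner_Heinz\<close>). That inequality is
  proved by Pedersen's spectral radius argument, which shows that the set of admissible exponents is closed under
  midpoints. Homogeneity and self-duality are laws of powers, and so is the determinant formula, since
  the weights are rational and the determinant is multiplicative and positive on positive definite matrices.

  The laws of powers come from the continuous functional calculus of a self-adjoint operator: it is well defined
  because the norm of \<open>p(A)\<close> is at most the supremum of \<open>\<bar>p\<bar>\<close> on the spectrum of \<open>A\<close>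
  (\<open>norm_op_poly_le\<close>), it is multiplicative and compatible with intertwiners, and \<open>f(g(A)) = (f \<circ> g)(A)\<close>
  (\<open>op_fun_calc_compose\<close>).
\<close>

section \<open>The real inner product and positive operators\<close>

text \<open>The real part of the complex inner product is a real inner product with the same norm. All
  estimates are made with it; complex linearity is carried along separately and only matters
  where the complex notions of positivity, spectrum and adjoint are unfolded.\<close>

definition rip :: "'a::complex_hilbert \<Rightarrow> 'a \<Rightarrow> real" where
  "rip x y = Re (cinner x y)"

lemma rip_commute: "rip x y = rip y x"
  unfolding rip_def by (metis cinner_commute complex_cnj_cancel_iff cnj.sel(1))

lemma rip_add_right: "rip x (y + z) = rip x y + rip x z"
  by (simp add: rip_def cinner_add_right)

lemma rip_add_left: "rip (x + y) z = rip x z + rip y z"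
  by (metis rip_add_right rip_commute)

lemma rip_scaleR_right: "rip x (r *\<^sub>R y) = r * rip x y"
  by (simp add: rip_def scaleR_scaleC cinner_scaleC_right)

lemma rip_scaleR_left: "rip (r *\<^sub>R x) y = r * rip x y"
  by (metis rip_scaleR_right rip_commute)

lemma rip_minus_right: "rip x (- y) = - rip x y"
  using rip_scaleR_right[of x "-1" y] by simp

lemma rip_minus_left: "rip (- x) y = - rip x y"
  by (metis rip_minus_right rip_commute)

lemma rip_diff_right: "rip x (y - z) = rip x y - rip x z"
  using rip_add_right[of x y "-z"] by (simp add: rip_minus_right)

lemma rip_diff_left: "rip (x - y) z = rip x z - rip y z"
  by (metis rip_diff_right rip_commute)

lemma rip_zero_right [simp]: "rip x 0 = 0"
  using rip_scaleR_right[of x 0 0] by simp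

lemma rip_zero_left [simp]: "rip 0 x = 0"
  using rip_scaleR_left[of 0 0 x] by simp

lemmas rip_linear = rip_add_right rip_add_left rip_diff_right rip_diff_left
  rip_scaleR_right rip_scaleR_left rip_minus_right rip_minus_left

lemma rip_self: "rip x x = (norm x)\<^sup>2"
proof -
  have "0 \<le> Re (cinner x x)"
    using cinner_ge_zero[of x] by (simp add: complex_nonneg_Reals_iff)
  then show ?thesis
    by (simp add: rip_def norm_eq_sqrt_cinner)
qed

lemma rip_eqI:
  assumes "\<And>x. rip x y = rip x z"
  shows "y = z"
proof -
  have "rip (y - z) (y - z) = 0"
    using assms[of "y - z"] by (simp add: rip_diff_right)
  then show ?thesis by (simp add: rip_self)
qed

definition rsymmetric :: "('a::complex_hilbert \<Rightarrow>\<^sub>L 'a) \<Rightarrow> bool" where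
  "rsymmetric A \<longleftrightarrow> (\<forall>x y. rip (A x) y = rip x (A y))"

lemma rsymmetricD: "rsymmetric A \<Longrightarrow> rip (A x) y = rip x (A y)"
  by (simp add: rsymmetric_def)

text \<open>A nonnegative quadratic polynomial has a nonpositive discriminant. It yields both the
  Cauchy--Schwarz inequality and, in the degenerate form \<open>a = 0\<close>, the vanishing of a first variation.\<close>

lemma discriminant_bound:
  fixes a b c :: real
  assumes "\<And>t. 0 \<le> a + 2 * t * b + t\<^sup>2 * c"
    and "0 \<le> c"
  shows "b\<^sup>2 \<le> a * c"
proof (cases "c = 0")
  case True
  \<comment> \<open>A linear function with \<open>b \<noteq> 0\<close> takes the value \<open>-1\<close> at \<open>- (a + 1) / (2 b)\<close>.\<close>
  have "b = 0"
  proof (rule ccontr)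
    assume b: "b \<noteq> 0"
    have "0 \<le> a + 2 * (- (a + 1) / (2 * b)) * b + (- (a + 1) / (2 * b))\<^sup>2 * c"
      by (rule assms(1))
    with b True show False by (simp add: field_simps)
  qed
  with True show ?thesis by simp
next
  case False
  with assms(2) have "c > 0" by simp
  have "0 \<le> a + 2 * (- b / c) * b + (- b / c)\<^sup>2 * c"
    by (rule assms(1))
  also have "\<dots> = (a * c - b\<^sup>2) / c"
    using \<open>c > 0\<close> by (simp add: field_simps power2_eq_square)
  finally show ?thesis
    using \<open>c > 0\<close> by (simp add: zero_le_divide_iff)
qed

lemma Cauchy_Schwarz_form:
  assumes "rsymmetric S" and "\<And>x. 0 \<le> rip x (S x)"
  shows "(rip x (S y))\<^sup>2 \<le> rip x (S x) * rip y (S y)"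
proof (rule discriminant_bound)
  fix t :: real
  have "rip y (S x) = rip x (S y)"
    using rsymmetricD[OF assms(1), of y x] rip_commute by metis
  then have "rip (x + t *\<^sub>R y) (S (x + t *\<^sub>R y)) = rip x (S x) + 2 * t * rip x (S y) + t\<^sup>2 * rip y (S y)"
    by (simp add: rip_linear blinfun.bilinear_simps algebra_simps power2_eq_square)
  then show "0 \<le> rip x (S x) + 2 * t * rip x (S y) + t\<^sup>2 * rip y (S y)"
    using assms(2)[of "x + t *\<^sub>R y"] by simp
qed (rule assms(2))

lemma rip_abs_le: "\<bar>rip x y\<bar> \<le> norm x * norm y"
proof -
  have "rsymmetric (id_blinfun :: 'a \<Rightarrow>\<^sub>L 'a)" by (simp add: rsymmetric_def)
  from Cauchy_Schwarz_form[OF this, of x y]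
  have "(rip x y)\<^sup>2 \<le> (norm x * norm y)\<^sup>2"
    by (simp add: rip_self power_mult_distrib)
  then show ?thesis
    by (metis abs_le_square_iff abs_of_nonneg mult_nonneg_nonneg norm_ge_zero)
qed

lemma rip_le: "rip x y \<le> norm x * norm y"
  using rip_abs_le[of x y] by simp

lemma bounded_linear_rip: "bounded_linear (\<lambda>y. rip x y)"
  by (rule bounded_linear_intro[of _ "norm x"])
     (auto simp: rip_linear intro: order_trans[OF rip_abs_le] simp: mult.commute)

lemma bounded_linear_rip_left: "bounded_linear (\<lambda>y. rip y x)"
  using bounded_linear_rip[of x] by (simp add: rip_commute)

text \<open>Complex identities can thus be read off from the real inner product at \<open>y\<close> and at \<open>\<i> y\<close>.\<close>

lemma Im_cinner: "Im (cinner x y) = - rip x (\<i> *\<^sub>C y)"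
  by (simp add: rip_def cinner_scaleC_right)

lemma rip_ii: "rip (\<i> *\<^sub>C x) y = - rip x (\<i> *\<^sub>C y)"
proof -
  have "rip (\<i> *\<^sub>C x) y = - Im (cinner y x)"
    by (simp add: rip_commute[of _ y] Im_cinner)
  also have "\<dots> = Im (cinner x y)"
    by (metis cinner_commute cnj.sel(2))
  finally show ?thesis by (simp add: Im_cinner)
qed

lemma cinner_eqI:
  assumes "rip x y = rip u v" and "rip x (\<i> *\<^sub>C y) = rip u (\<i> *\<^sub>C v)"
  shows "cinner x y = cinner u v"
  using assms by (simp add: complex_eq_iff Im_cinner) (simp add: rip_def)

definition self_adjoint :: "('a::complex_hilbert \<Rightarrow>\<^sub>L 'a) \<Rightarrow> bool" where
  "self_adjoint A \<longleftrightarrow> clinear_op A \<and> rsymmetric A"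

lemma self_adjointD:
  assumes "self_adjoint A"
  shows "clinear_op A" and "rsymmetric A" and "rip (A x) y = rip x (A y)"
  using assms by (auto simp: self_adjoint_def rsymmetric_def)

lemma clinear_opD: "clinear_op A \<Longrightarrow> A (c *\<^sub>C x) = c *\<^sub>C A x"
  by (simp add: clinear_op_def)

lemma clinear_scaleR: "clinear_op A \<Longrightarrow> clinear_op (r *\<^sub>R A)"
  by (simp add: clinear_op_def blinfun.bilinear_simps scaleR_scaleC scaleC_scaleC mult.commute)

lemma scaleC_minus_right: "c *\<^sub>C (- x) = - (c *\<^sub>C (x::'a::complex_hilbert))"
proof -
  have "c *\<^sub>C ((-1) *\<^sub>R x) = (-1) *\<^sub>R (c *\<^sub>C x)"
    by (simp add: scaleR_scaleC scaleC_scaleC mult.commute del: scaleR_minus1_left)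
  then show ?thesis by simp
qed

lemma scaleC_ii_ii: "\<i> *\<^sub>C \<i> *\<^sub>C x = - x"
  using scaleR_scaleC[of "-1" x] by (simp add: scaleC_scaleC)

lemma clinear_minus: "clinear_op A \<Longrightarrow> clinear_op (- A)"
  by (simp add: clinear_op_def blinfun.bilinear_simps scaleC_minus_right)

lemma clinear_add: "clinear_op A \<Longrightarrow> clinear_op B \<Longrightarrow> clinear_op (A + B)"
  by (simp add: clinear_op_def blinfun.bilinear_simps scaleC_add_right)

lemma clinear_diff: "clinear_op A \<Longrightarrow> clinear_op B \<Longrightarrow> clinear_op (A - B)"
  using clinear_add[of A "- B"] clinear_minus[of B] by simp

lemma clinear_compose: "clinear_op A \<Longrightarrow> clinear_op B \<Longrightarrow> clinear_op (A o\<^sub>L B)"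
  by (simp add: clinear_op_def)

lemma clinear_id: "clinear_op id_blinfun"
  by (simp add: clinear_op_def)

lemmas clinear_intros = clinear_id clinear_compose clinear_add clinear_diff clinear_minus clinear_scaleR

lemma rsymmetric_add: "rsymmetric A \<Longrightarrow> rsymmetric B \<Longrightarrow> rsymmetric (A + B)"
  and rsymmetric_diff: "rsymmetric A \<Longrightarrow> rsymmetric B \<Longrightarrow> rsymmetric (A - B)"
  and rsymmetric_scaleR: "rsymmetric A \<Longrightarrow> rsymmetric (r *\<^sub>R A)"
  and rsymmetric_id: "rsymmetric id_blinfun"
  by (simp_all add: rsymmetric_def blinfun.bilinear_simps rip_linear)

lemma rsymmetric_sandwich: "rsymmetric S \<Longrightarrow> rsymmetric A \<Longrightarrow> rsymmetric (S o\<^sub>L A o\<^sub>L S)"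
  by (simp add: rsymmetric_def)

lemma rsymmetric_compose:
  "rsymmetric A \<Longrightarrow> rsymmetric B \<Longrightarrow> A o\<^sub>L B = B o\<^sub>L A \<Longrightarrow> rsymmetric (A o\<^sub>L B)"
  unfolding rsymmetric_def by (metis blinfun_apply_blinfun_compose)

lemma self_adjoint_add: "self_adjoint A \<Longrightarrow> self_adjoint B \<Longrightarrow> self_adjoint (A + B)"
  and self_adjoint_diff: "self_adjoint A \<Longrightarrow> self_adjoint B \<Longrightarrow> self_adjoint (A - B)"
  and self_adjoint_scaleR: "self_adjoint A \<Longrightarrow> self_adjoint (r *\<^sub>R A)"
  and self_adjoint_id: "self_adjoint id_blinfun"
  and self_adjoint_sandwich: "self_adjoint S \<Longrightarrow> self_adjoint A \<Longrightarrow> self_adjoint (S o\<^sub>L A o\<^sub>L S)"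
  and self_adjoint_compose:
    "self_adjoint A \<Longrightarrow> self_adjoint B \<Longrightarrow> A o\<^sub>L B = B o\<^sub>L A \<Longrightarrow> self_adjoint (A o\<^sub>L B)"
  unfolding self_adjoint_def
  by (auto intro: clinear_intros rsymmetric_add rsymmetric_diff
        rsymmetric_scaleR rsymmetric_id rsymmetric_sandwich rsymmetric_compose)

lemmas self_adjoint_intros = self_adjoint_add self_adjoint_diff
  self_adjoint_scaleR self_adjoint_id self_adjoint_sandwich

text \<open>Polarisation: if \<open>x \<mapsto> \<langle>x, A x\<rangle>\<close> is real, then comparing its values at \<open>x + \<i> y\<close>, \<open>x\<close>
  and \<open>\<i> y\<close> shows that \<open>A\<close> is symmetric. Conversely, symmetry at \<open>(x, \<i> x)\<close> makes the imaginary
  part of \<open>\<langle>x, A x\<rangle>\<close> equal to its own negative.\<close>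

lemma op_positive_iff: "op_positive A \<longleftrightarrow> self_adjoint A \<and> (\<forall>x. 0 \<le> rip x (A x))"
proof
  assume pos: "op_positive A"
  then have lin: "clinear_op A" by (simp add: op_positive_def)
  have re: "0 \<le> rip x (A x)" and im: "rip x (\<i> *\<^sub>C A x) = 0" for x
    using pos Im_cinner[of x "A x"] by (auto simp: op_positive_def complex_nonneg_Reals_iff rip_def)
  have "rip (A x) y = rip x (A y)" for x y
  proof -
    have "rip (x + \<i> *\<^sub>C y) (\<i> *\<^sub>C A (x + \<i> *\<^sub>C y)) = 0" by (rule im)
    then have "rip x (\<i> *\<^sub>C \<i> *\<^sub>C A y) + rip (\<i> *\<^sub>C y) (\<i> *\<^sub>C A x) = 0"
      using im[of x] im[of "\<i> *\<^sub>C y"]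
      by (simp add: blinfun.bilinear_simps clinear_opD[OF lin] scaleC_add_right rip_linear)
    then have "rip x (A y) = rip y (A x)"
      by (simp add: rip_ii scaleC_ii_ii rip_minus_right)
    then show ?thesis by (simp add: rip_commute)
  qed
  with re lin show "self_adjoint A \<and> (\<forall>x. 0 \<le> rip x (A x))"
    by (auto simp: self_adjoint_def rsymmetric_def)
next
  assume sa: "self_adjoint A \<and> (\<forall>x. 0 \<le> rip x (A x))"
  have "rip x (\<i> *\<^sub>C A x) = 0" for x
  proof -
    have "rip (A x) (\<i> *\<^sub>C x) = rip x (\<i> *\<^sub>C A x)"
      using sa self_adjointD(3)[of A x "\<i> *\<^sub>C x"] by (simp add: self_adjointD clinear_opD)
    then show ?thesis
      using rip_ii[of x "A x"] by (simp add: rip_commute)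
  qed
  then show "op_positive A"
    using sa by (auto simp: op_positive_def complex_nonneg_Reals_iff Im_cinner self_adjoint_def rip_def)
qed

lemma op_positiveD:
  assumes "op_positive A"
  shows "self_adjoint A" and "0 \<le> rip x (A x)"
  using assms by (auto simp: op_positive_iff)

lemma loewner_le_iff:
  assumes "self_adjoint A" "self_adjoint B"
  shows "A \<le>\<^sub>L B \<longleftrightarrow> (\<forall>x. rip x (A x) \<le> rip x (B x))"
  using assms by (simp add: loewner_le_def op_positive_iff self_adjoint_diff blinfun.bilinear_simps rip_linear)

section \<open>The adjoint\<close>

text \<open>The Riesz representation: the convex functional \<open>x \<mapsto> norm x ^ 2 - 2 f x\<close> is bounded below,
  the parallelogram law makes its minimising sequences converge, and the first variation at a
  minimiser \<open>z\<close> says \<open>f x = rip z x\<close>.\<close>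

lemma Riesz_representation:
  fixes f :: "'a::complex_hilbert \<Rightarrow> real"
  assumes f: "bounded_linear f"
  obtains z where "\<And>x. f x = rip z x"
proof -
  interpret f: bounded_linear f by fact
  obtain K where K: "\<And>x. \<bar>f x\<bar> \<le> norm x * K" using f.bounded by auto
  define F where "F x = (norm x)\<^sup>2 - 2 * f x" for x
  have below: "- K\<^sup>2 \<le> F x" for x
  proof -
    have "0 \<le> (norm x - K)\<^sup>2" by simp
    with K[of x] show ?thesis by (simp add: F_def power2_diff)
  qed
  then have bdd: "bdd_below (range F)" by (auto intro!: bdd_belowI)
  define m where "m = Inf (range F)"
  have mF: "m \<le> F x" for x unfolding m_def by (rule cInf_lower[OF _ bdd]) simp
  have "\<exists>x. F x < m + 1 / real (Suc n)" for n
    using cInf_lessD[of "range F" "m + 1 / real (Suc n)"] by (auto simp: m_def)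
  then obtain X where X: "\<And>n. F (X n) < m + 1 / real (Suc n)" by metis
  have par: "(norm (x - y))\<^sup>2 = 2 * F x + 2 * F y - 4 * F ((1/2) *\<^sub>R (x + y))" for x y
    unfolding F_def rip_self[symmetric]
    by (simp add: rip_linear f.add f.scaleR rip_commute[of y x] algebra_simps)
  have dist: "(norm (X i - X j))\<^sup>2 \<le> 4 / real (Suc N)" if "i \<ge> N" "j \<ge> N" for i j N
  proof -
    have "1 / real (Suc i) \<le> 1 / real (Suc N)" "1 / real (Suc j) \<le> 1 / real (Suc N)"
      using that by (auto simp: field_simps)
    then show ?thesis
      using X[of i] X[of j] mF[of "(1/2) *\<^sub>R (X i + X j)"] unfolding par by simp
  qed
  have "Cauchy X"
  proof (rule metric_CauchyI)
    fix e :: real assume e: "e > 0"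
    then obtain N where N: "4 / e\<^sup>2 < real (Suc N)"
      using reals_Archimedean2 less_trans of_nat_less_iff lessI by metis
    show "\<exists>M. \<forall>m\<ge>M. \<forall>n\<ge>M. dist (X m) (X n) < e"
    proof (intro exI allI impI)
      fix i j assume "N \<le> i" "N \<le> j"
      from dist[OF this] have "(norm (X i - X j))\<^sup>2 \<le> 4 / real (Suc N)" .
      also have "\<dots> < e\<^sup>2" using N e by (simp add: field_simps)
      finally show "dist (X i) (X j) < e"
        using e by (metis dist_norm less_eq_real_def power2_less_imp_less)
    qed
  qed
  then obtain z where z: "X \<longlonglongrightarrow> z" using Cauchy_convergent convergent_def by blast
  have "(\<lambda>n. F (X n)) \<longlonglongrightarrow> F z"
    unfolding F_def by (intro tendsto_intros z f.tendsto)
  moreover have "(\<lambda>n. m + 1 / real (Suc n)) \<longlonglongrightarrow> m + 0"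
    by (intro tendsto_intros LIMSEQ_inverse_real_of_nat[unfolded inverse_eq_divide])
  ultimately have "F z \<le> m + 0"
    by (rule LIMSEQ_le) (use X less_imp_le in blast)
  then have min: "F z \<le> F x" for x using mF[of x] by simp
  have "f x = rip z x" for x
  proof -
    have "0 \<le> 0 + 2 * t * (rip z x - f x) + t\<^sup>2 * (norm x)\<^sup>2" for t
    proof -
      have "F (z + t *\<^sub>R x) - F z = 0 + 2 * t * (rip z x - f x) + t\<^sup>2 * (norm x)\<^sup>2"
        unfolding F_def
        by (simp add: rip_self[symmetric] rip_linear f.add f.scaleR rip_commute[of x z])
           (simp add: algebra_simps power2_eq_square)
      with min[of "z + t *\<^sub>R x"] show ?thesis by simp
    qed
    from discriminant_bound[OF this] show ?thesis by simp
  qed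
  then show ?thesis by (rule that)
qed

text \<open>Stated with the real inner product, so that it makes sense for real-linear operators; for a complex-linear
  operator it determines the usual adjoint.\<close>

definition is_adjoint :: "('a::complex_hilbert \<Rightarrow>\<^sub>L 'a) \<Rightarrow> ('a \<Rightarrow>\<^sub>L 'a) \<Rightarrow> bool" where
  "is_adjoint A B \<longleftrightarrow> (\<forall>x y. rip (A x) y = rip x (B y))"

lemma is_adjointD: "is_adjoint A B \<Longrightarrow> rip (A x) y = rip x (B y)"
  by (simp add: is_adjoint_def)

lemma is_adjoint_compose: "is_adjoint A A' \<Longrightarrow> is_adjoint B B' \<Longrightarrow> is_adjoint (A o\<^sub>L B) (B' o\<^sub>L A')"
  by (simp add: is_adjoint_def)

lemma is_adjoint_unique: "is_adjoint A B \<Longrightarrow> is_adjoint A B' \<Longrightarrow> B = B'"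
  by (rule blinfun_eqI, rule rip_eqI) (metis is_adjoint_def)

lemma is_adjoint_self: "rsymmetric A \<Longrightarrow> is_adjoint A A"
  by (simp add: is_adjoint_def rsymmetric_def)

lemma norm_adjoint_le:
  assumes "is_adjoint A B"
  shows "norm B \<le> norm A"
proof (rule norm_blinfun_bound)
  fix y
  have "(norm (B y))\<^sup>2 = rip (A (B y)) y"
    by (simp add: is_adjointD[OF assms] rip_self)
  also have "\<dots> \<le> norm (A (B y)) * norm y" by (rule rip_le)
  also have "\<dots> \<le> norm A * norm (B y) * norm y"
    by (intro mult_right_mono norm_blinfun) simp
  finally show "norm (B y) \<le> norm A * norm y"
    by (cases "norm (B y) = 0") (auto simp: power2_eq_square mult.assoc mult.left_commute)
qed simp

text \<open>Since \<open>c = Re c + Im c * \<i>\<close>, only commutation with \<open>\<i>\<close> is at stake, and \<open>\<i>\<close> is skew-symmetric for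
  the real inner product.\<close>

lemma clinear_adjoint:
  assumes "is_adjoint A B" "clinear_op A"
  shows "clinear_op B"
  unfolding clinear_op_def
proof (intro allI)
  fix c :: complex and y :: 'a
  have ii: "B (\<i> *\<^sub>C x) = \<i> *\<^sub>C B x" for x
  proof (rule rip_eqI)
    fix u
    have "rip u (B (\<i> *\<^sub>C x)) = rip (A u) (\<i> *\<^sub>C x)" by (simp add: is_adjointD[OF assms(1)])
    also have "\<dots> = - rip (A (\<i> *\<^sub>C u)) x" by (simp add: rip_ii clinear_opD[OF assms(2)])
    also have "\<dots> = rip u (\<i> *\<^sub>C B x)" by (simp add: is_adjointD[OF assms(1)] rip_ii)
    finally show "rip u (B (\<i> *\<^sub>C x)) = rip u (\<i> *\<^sub>C B x)" .
  qed
  have split: "c *\<^sub>C x = Re c *\<^sub>R x + Im c *\<^sub>R (\<i> *\<^sub>C x)" for x :: 'a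
    unfolding scaleR_scaleC scaleC_scaleC scaleC_add_left[symmetric]
    by (rule arg_cong[where f = "\<lambda>c. c *\<^sub>C x"]) (simp add: complex_eq_iff)
  show "B (c *\<^sub>C y) = c *\<^sub>C B y"
    by (simp add: split blinfun.bilinear_simps ii)
qed

lemma is_adjoint_cinner:
  assumes "is_adjoint A B" "clinear_op A"
  shows "cinner (A x) y = cinner x (B y)"
  using clinear_adjoint[OF assms]
  by (intro cinner_eqI) (auto simp: is_adjointD[OF assms(1)] clinear_opD)

lemma adjoint_exists:
  fixes A :: "'a::complex_hilbert \<Rightarrow>\<^sub>L 'a"
  obtains B where "is_adjoint A B"
proof -
  have "\<exists>z. \<forall>x. rip (A x) y = rip z x" for y
  proof -
    have "bounded_linear (\<lambda>x. rip (A x) y)"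
      using bounded_linear_compose[OF bounded_linear_rip_left[of y] blinfun.bounded_linear_right[of A]] .
    from Riesz_representation[OF this] show ?thesis by metis
  qed
  then obtain b where "\<And>x y. rip (A x) y = rip (b y) x" by metis
  then have b: "rip x (b y) = rip (A x) y" for x y by (simp add: rip_commute)
  have "bounded_linear b"
  proof (rule bounded_linear_intro)
    fix x y :: 'a and r :: real
    show "b (x + y) = b x + b y" "b (r *\<^sub>R x) = r *\<^sub>R b x"
      by (rule rip_eqI; simp add: rip_linear b)+
    have "(norm (b x))\<^sup>2 = rip (A (b x)) x" by (simp add: b flip: rip_self)
    also have "\<dots> \<le> norm (A (b x)) * norm x" by (rule rip_le)
    also have "\<dots> \<le> norm A * norm (b x) * norm x"
      by (intro mult_right_mono norm_blinfun) simp
    finally show "norm (b x) \<le> norm x * norm A"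
      by (cases "norm (b x) = 0") (auto simp: power2_eq_square mult.assoc mult.left_commute mult.commute)
  qed
  then have "is_adjoint A (Blinfun b)"
    by (simp add: is_adjoint_def bounded_linear_Blinfun_apply b)
  then show ?thesis by (rule that)
qed

lemma is_adjoint_op_adjoint:
  assumes "clinear_op A"
  shows "is_adjoint A (op_adjoint A)"
proof -
  obtain B where B: "is_adjoint A B" by (rule adjoint_exists)
  have "op_adjoint A = B"
    unfolding op_adjoint_def
  proof (rule the_equality)
    show "\<forall>x y. cinner (A x) y = cinner x (B y)"
      using is_adjoint_cinner[OF B assms] by blast
    fix B' assume "\<forall>x y. cinner (A x) y = cinner x (blinfun_apply B' y)"
    then have "is_adjoint A B'" by (simp add: is_adjoint_def rip_def)
    with B show "B' = B" using is_adjoint_unique by blast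
  qed
  with B show ?thesis by simp
qed

section \<open>Inverses and the real spectrum\<close>

interpretation compose: bounded_bilinear "(o\<^sub>L)"
  by (rule bounded_bilinear_blinfun_compose)

lemma compose_assoc: "A o\<^sub>L B o\<^sub>L C = A o\<^sub>L (B o\<^sub>L C)"
  by (rule blinfun_eqI) simp

lemma compose_id [simp]: "id_blinfun o\<^sub>L A = A" "A o\<^sub>L id_blinfun = A"
  by (rule blinfun_eqI; simp)+

lemmas compose_linear = compose.add_left compose.add_right compose.diff_left compose.diff_right
  compose.minus_left compose.minus_right compose.scaleR_left compose.scaleR_right

definition is_inverse :: "('a::complex_hilbert \<Rightarrow>\<^sub>L 'a) \<Rightarrow> ('a \<Rightarrow>\<^sub>L 'a) \<Rightarrow> bool" where
  "is_inverse A B \<longleftrightarrow> A o\<^sub>L B = id_blinfun \<and> B o\<^sub>L A = id_blinfun"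

lemma is_inverse_apply:
  assumes "is_inverse A B"
  shows "A (B x) = x" and "B (A x) = x"
proof -
  have "blinfun_apply (A o\<^sub>L B) x = x" "blinfun_apply (B o\<^sub>L A) x = x"
    using assms by (auto simp: is_inverse_def)
  then show "A (B x) = x" "B (A x) = x" by auto
qed

lemma is_inverseI:
  fixes A B :: "'a::complex_hilbert \<Rightarrow>\<^sub>L 'a"
  shows "(\<And>x. A (B x) = x) \<Longrightarrow> (\<And>x. B (A x) = x) \<Longrightarrow> is_inverse A B"
  by (auto simp: is_inverse_def intro: blinfun_eqI)

lemma is_inverse_sym: "is_inverse A B \<Longrightarrow> is_inverse B A"
  by (simp add: is_inverse_def)

lemma is_inverse_compose:
  "is_inverse A A' \<Longrightarrow> is_inverse B B' \<Longrightarrow> is_inverse (A o\<^sub>L B) (B' o\<^sub>L A')"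
  by (auto intro!: is_inverseI simp: is_inverse_apply)

lemma is_inverse_scaleR: "is_inverse A B \<Longrightarrow> r \<noteq> 0 \<Longrightarrow> is_inverse (r *\<^sub>R A) ((1 / r) *\<^sub>R B)"
  by (auto intro!: is_inverseI simp: is_inverse_apply blinfun.bilinear_simps)

lemma is_inverse_unique: "is_inverse A B \<Longrightarrow> is_inverse A B' \<Longrightarrow> B = B'"
  using compose_assoc[of B A B'] by (simp add: is_inverse_def)

lemma op_inverse_eq: "is_inverse A B \<Longrightarrow> op_inverse A = B"
  unfolding op_inverse_def using is_inverse_unique by (auto simp: is_inverse_def)

lemma clinear_inverse:
  assumes "is_inverse A B" "clinear_op A"
  shows "clinear_op B"
  unfolding clinear_op_def
proof (intro allI)
  fix c x
  have "B (c *\<^sub>C x) = B (c *\<^sub>C A (B x))" by (simp add: is_inverse_apply[OF assms(1)])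
  also have "\<dots> = B (A (c *\<^sub>C B x))" by (simp add: clinear_opD[OF assms(2)])
  finally show "B (c *\<^sub>C x) = c *\<^sub>C B x" by (simp add: is_inverse_apply[OF assms(1)])
qed

lemma op_invertible_iff: "op_invertible A \<longleftrightarrow> clinear_op A \<and> (\<exists>B. is_inverse A B)"
  unfolding op_invertible_def using clinear_inverse by (auto simp: is_inverse_def)

lemma is_adjoint_inverse:
  assumes "is_adjoint A A'" "is_inverse A B" "is_adjoint B B'"
  shows "is_inverse A' B'"
proof (rule is_inverseI)
  show "A' (B' x) = x" "B' (A' x) = x" for x
    by (rule rip_eqI; simp add: is_inverse_apply[OF assms(2)]
        is_adjointD[OF assms(1), symmetric] is_adjointD[OF assms(3), symmetric])+
qed

text \<open>The equation \<open>x = K x + y\<close> has a unique solution by the contraction principle.\<close>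

lemma Neumann_inverse:
  fixes K :: "'a::complex_hilbert \<Rightarrow>\<^sub>L 'a"
  assumes K: "norm K < 1"
  shows "\<exists>B. is_inverse (id_blinfun - K) B"
proof -
  have ex1: "\<exists>!x. K x + y = x" for y
  proof (rule banach_fix_type[of "norm K"])
    show "\<forall>u v. dist (K u + y) (K v + y) \<le> norm K * dist u v"
      by (auto simp: dist_norm blinfun.diff_right[symmetric] intro: norm_blinfun)
  qed (use K in auto)
  define b where "b y = (THE x. K x + y = x)" for y
  have b: "K (b y) + y = b y" for y
    unfolding b_def by (rule theI'[OF ex1])
  have b_eq: "x = b y" if "K x + y = x" for x y
    using ex1[of y] b[of y] that by blast
  have "bounded_linear b"
  proof (rule bounded_linear_intro)
    fix x y :: 'a and r :: real
    have "K (b x + b y) + (x + y) = (K (b x) + x) + (K (b y) + y)"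
      by (simp add: blinfun.add_right)
    then show "b (x + y) = b x + b y"
      unfolding b by (rule b_eq[symmetric])
    show "b (r *\<^sub>R x) = r *\<^sub>R b x"
      by (rule b_eq[symmetric]) (use b[of x] in \<open>simp add: blinfun.bilinear_simps flip: scaleR_add_right\<close>)
    have "norm (b x) \<le> norm (K (b x)) + norm x"
      using norm_triangle_ineq[of "K (b x)" x] by (simp add: b)
    also have "\<dots> \<le> norm K * norm (b x) + norm x"
      by (simp add: norm_blinfun)
    finally have "norm (b x) * (1 - norm K) \<le> norm x" by (simp add: algebra_simps)
    then show "norm (b x) \<le> norm x * (1 / (1 - norm K))"
      using K by (simp add: field_simps)
  qed
  note apply_b = bounded_linear_Blinfun_apply[OF this]
  have "is_inverse (id_blinfun - K) (Blinfun b)"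
  proof (rule is_inverseI)
    show "(id_blinfun - K) (Blinfun b x) = x" for x
      using b[of x] by (simp add: apply_b blinfun.bilinear_simps algebra_simps)
    show "Blinfun b ((id_blinfun - K) x) = x" for x
      by (simp add: apply_b blinfun.bilinear_simps) (rule b_eq[symmetric], simp)
  qed
  then show ?thesis by blast
qed

text \<open>The Cauchy--Schwarz inequality of the form \<open>\<langle>x, S y\<rangle>\<close>, taken at the vectors \<open>S x\<close> and \<open>x\<close>, bounds
  \<open>norm (S x)\<close> by the numerical range.\<close>

lemma norm_le_form_bound:
  assumes "rsymmetric S" "\<And>x. 0 \<le> rip x (S x)" "\<And>x. rip x (S x) \<le> c * (norm x)\<^sup>2" "0 \<le> c"
  shows "norm S \<le> c"
proof (rule norm_blinfun_bound[OF assms(4)])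
  fix x
  have "(norm (S x))\<^sup>2 * (norm (S x))\<^sup>2 = (rip (S x) (S x))\<^sup>2"
    by (simp add: rip_self power2_eq_square)
  also have "\<dots> \<le> rip (S x) (S (S x)) * rip x (S x)"
    by (rule Cauchy_Schwarz_form[OF assms(1,2)])
  also have "\<dots> \<le> (c * (norm (S x))\<^sup>2) * (c * (norm x)\<^sup>2)"
    by (intro mult_mono assms) (simp_all add: assms(4))
  finally have *: "(norm (S x))\<^sup>2 * (norm (S x))\<^sup>2 \<le> (norm (S x))\<^sup>2 * (c * norm x)\<^sup>2"
    by (simp add: power_mult_distrib power2_eq_square algebra_simps)
  show "norm (S x) \<le> c * norm x"
  proof (cases "norm (S x) = 0")
    case False
    then have "(norm (S x))\<^sup>2 > 0" by simp
    with * have "(norm (S x))\<^sup>2 \<le> (c * norm x)\<^sup>2" by (simp only: mult_le_cancel_left_pos)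
    then show ?thesis by (rule power2_le_imp_le) (simp add: assms(4))
  qed (use assms(4) in simp)
qed

text \<open>For \<open>M\<close> above the norm of \<open>A\<close>, the form of \<open>1 - A / M\<close> lies between \<open>0\<close> and \<open>1 - e / M\<close>, so that the Neumann
  series applies to \<open>A / M\<close>.\<close>

lemma inverse_of_positive_bounded_below:
  fixes A :: "'a::complex_hilbert \<Rightarrow>\<^sub>L 'a"
  assumes A: "rsymmetric A" and e: "e > 0" and below: "\<And>x. e * (norm x)\<^sup>2 \<le> rip x (A x)"
  shows "\<exists>B. is_inverse A B"
proof -
  define M where "M = norm A + e"
  have M: "M > 0" "e \<le> M" using e by (auto simp: M_def add_nonneg_pos)
  define K where "K = id_blinfun - (1 / M) *\<^sub>R A"
  have K_form: "rip x (K x) = (norm x)\<^sup>2 - rip x (A x) / M" for x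
    by (simp add: K_def blinfun.bilinear_simps rip_linear rip_self)
  have above: "rip x (A x) \<le> M * (norm x)\<^sup>2" for x
  proof -
    have "rip x (A x) \<le> norm x * norm (A x)" by (rule rip_le)
    also have "\<dots> \<le> norm x * (M * norm x)"
      using norm_blinfun[of A x] mult_right_mono[of "norm A" M "norm x"] e
      by (intro mult_left_mono) (auto simp: M_def)
    finally show ?thesis by (simp add: power2_eq_square algebra_simps)
  qed
  have "norm K \<le> 1 - e / M"
  proof (rule norm_le_form_bound)
    show "rsymmetric K"
      unfolding K_def by (intro rsymmetric_diff rsymmetric_id rsymmetric_scaleR A)
    show "0 \<le> rip x (K x)" for x
      using above[of x] M by (simp add: K_form field_simps)
    show "rip x (K x) \<le> (1 - e / M) * (norm x)\<^sup>2" for x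
      using below[of x] M by (simp add: K_form field_simps)
  qed (use M in simp)
  also have "\<dots> < 1" using e M by simp
  finally obtain B where B: "is_inverse (id_blinfun - K) B" using Neumann_inverse by blast
  have "is_inverse (M *\<^sub>R (id_blinfun - K)) ((1 / M) *\<^sub>R B)"
    using B M by (intro is_inverse_scaleR) auto
  then show ?thesis using M by (auto simp: K_def)
qed

text \<open>The same inequality at \<open>x\<close> and \<open>S\<inverse> x\<close> bounds the form from below in terms of \<open>norm S\<inverse>\<close>.\<close>

lemma positive_inverse_bounded_below:
  assumes S: "rsymmetric S" "\<And>x. 0 \<le> rip x (S x)" and B: "is_inverse S B"
  obtains e where "e > 0" "\<And>x. e * (norm x)\<^sup>2 \<le> rip x (S x)"
proof
  define N where "N = norm B + 1"
  have N: "N > 0" by (simp add: N_def add_nonneg_pos)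
  show "1 / N > 0" using N by simp
  fix x
  have "rip x (B x) \<le> norm x * norm (B x)" by (rule rip_le)
  also have "\<dots> \<le> norm x * (N * norm x)"
    using norm_blinfun[of B x] mult_right_mono[of "norm B" N "norm x"]
    by (intro mult_left_mono) (auto simp: N_def)
  finally have Bx: "rip x (B x) \<le> N * (norm x)\<^sup>2" by (simp add: power2_eq_square algebra_simps)
  have "(norm x)\<^sup>2 * (norm x)\<^sup>2 = (rip x (S (B x)))\<^sup>2"
    by (simp add: is_inverse_apply[OF B] rip_self power2_eq_square)
  also have "\<dots> \<le> rip x (S x) * rip (B x) (S (B x))"
    by (rule Cauchy_Schwarz_form[OF S])
  also have "\<dots> = rip x (S x) * rip x (B x)"
    by (simp add: is_inverse_apply[OF B] rip_commute)
  also have "\<dots> \<le> rip x (S x) * (N * (norm x)\<^sup>2)"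
    by (intro mult_left_mono Bx S)
  finally have *: "(norm x)\<^sup>2 * (norm x)\<^sup>2 \<le> (N * rip x (S x)) * (norm x)\<^sup>2"
    by (simp add: algebra_simps)
  have "(norm x)\<^sup>2 \<le> N * rip x (S x)"
  proof (cases "x = 0")
    case False
    then have "(norm x)\<^sup>2 > 0" by simp
    with * show ?thesis by (simp only: mult_le_cancel_right_pos)
  qed simp
  then show "1 / N * (norm x)\<^sup>2 \<le> rip x (S x)"
    using N by (simp add: field_simps)
qed

text \<open>With \<open>c = norm T\<close>, invertibility of both \<open>c - T\<close> and \<open>c + T\<close> would bound the positive
  operator \<open>c\<^sup>2 - T\<^sup>2\<close> away from \<open>0\<close>, so that \<open>norm (T x) < c * norm x\<close> uniformly in \<open>x\<close>.\<close>

lemma norm_is_spectral: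
  assumes T: "rsymmetric T" and c: "c = norm T" "c > 0"
    and inv: "is_inverse (T - c *\<^sub>R id_blinfun) B" "is_inverse (T + c *\<^sub>R id_blinfun) B'"
  shows False
proof -
  let ?S = "c\<^sup>2 *\<^sub>R id_blinfun - (T o\<^sub>L T)"
  have "is_inverse ((-1) *\<^sub>R (T - c *\<^sub>R id_blinfun) o\<^sub>L (T + c *\<^sub>R id_blinfun)) (B' o\<^sub>L (1 / (-1)) *\<^sub>R B)"
    by (intro is_inverse_compose is_inverse_scaleR inv) simp
  moreover have "((-1) *\<^sub>R (T - c *\<^sub>R id_blinfun) o\<^sub>L (T + c *\<^sub>R id_blinfun)) = ?S"
    by (simp add: compose_linear algebra_simps power2_eq_square)
  ultimately have inv_S: "is_inverse ?S (B' o\<^sub>L (1 / (-1)) *\<^sub>R B)" by simp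
  have S_form: "rip x (?S x) = c\<^sup>2 * (norm x)\<^sup>2 - (norm (T x))\<^sup>2" for x
    using rsymmetricD[OF T, of x "T x"]
    by (simp add: blinfun.bilinear_simps rip_linear rip_self)
  have "rsymmetric ?S"
    by (intro rsymmetric_diff rsymmetric_scaleR rsymmetric_id rsymmetric_compose T refl)
  moreover have "0 \<le> rip x (?S x)" for x
  proof -
    have "(norm (T x))\<^sup>2 \<le> (c * norm x)\<^sup>2"
      unfolding c by (intro power_mono norm_blinfun) simp
    then show ?thesis by (simp add: S_form power_mult_distrib)
  qed
  ultimately obtain e where e: "e > 0" "\<And>x. e * (norm x)\<^sup>2 \<le> rip x (?S x)"
    using positive_inverse_bounded_below[OF _ _ inv_S] by metis
  define d where "d = sqrt (max 0 (c\<^sup>2 - e))"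
  have "norm T \<le> d"
  proof (rule norm_blinfun_bound)
    fix x
    have "(norm (T x))\<^sup>2 \<le> (c\<^sup>2 - e) * (norm x)\<^sup>2"
      using e(2)[of x] by (simp add: S_form algebra_simps)
    also have "\<dots> \<le> max 0 (c\<^sup>2 - e) * (norm x)\<^sup>2"
      by (intro mult_right_mono) auto
    also have "\<dots> = (d * norm x)\<^sup>2" by (simp add: d_def power_mult_distrib)
    finally show "norm (T x) \<le> d * norm x"
      by (rule power2_le_imp_le) (simp add: d_def)
  qed (simp add: d_def)
  moreover have "d < sqrt (c\<^sup>2)"
    unfolding d_def using e(1) c(2) by (intro real_sqrt_less_mono) simp
  ultimately show False using c by simp
qed

text \<open>A self-adjoint operator has real spectrum, and the functional calculus tests uniform convergence
  on exactly this set.\<close>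

definition rspec :: "('a::complex_hilbert \<Rightarrow>\<^sub>L 'a) \<Rightarrow> real set" where
  "rspec A = {x. complex_of_real x \<in> op_spectrum A}"

lemma rspec_iff:
  fixes A :: "'a::complex_hilbert \<Rightarrow>\<^sub>L 'a"
  assumes "clinear_op A"
  shows "x \<in> rspec A \<longleftrightarrow> \<not> (\<exists>B. is_inverse (A - x *\<^sub>R id_blinfun) B)"
proof -
  have "(\<lambda>y::'a. complex_of_real x *\<^sub>C y) = blinfun_apply (x *\<^sub>R id_blinfun)"
    by (auto simp: scaleR_scaleC blinfun.bilinear_simps)
  then have "(scalar_op (complex_of_real x) :: 'a \<Rightarrow>\<^sub>L 'a) = x *\<^sub>R id_blinfun"
    by (metis scalar_op_def blinfun_apply_inverse)
  then show ?thesis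
    using assms by (auto simp: rspec_def op_spectrum_def op_invertible_iff intro: clinear_intros)
qed

lemma rspec_within:
  assumes A: "self_adjoint A"
    and m: "\<And>x. m * (norm x)\<^sup>2 \<le> rip x (A x)" and M: "\<And>x. rip x (A x) \<le> M * (norm x)\<^sup>2"
  shows "rspec A \<subseteq> {m..M}"
proof
  fix z assume z: "z \<in> rspec A"
  have rsym: "rsymmetric A" using A by (simp add: self_adjointD)
  have no: "\<not> is_inverse (A - z *\<^sub>R id_blinfun) B" for B
    using z rspec_iff[of A z] A by (auto simp: self_adjointD)
  have "\<not> z < m"
  proof
    assume "z < m"
    have "\<exists>B. is_inverse (A - z *\<^sub>R id_blinfun) B"
    proof (rule inverse_of_positive_bounded_below)
      show "m - z > 0" using \<open>z < m\<close> by simp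
      show "(m - z) * (norm x)\<^sup>2 \<le> rip x ((A - z *\<^sub>R id_blinfun) x)" for x
        using m[of x] by (simp add: blinfun.bilinear_simps rip_linear rip_self algebra_simps)
    qed (intro rsymmetric_diff rsymmetric_scaleR rsymmetric_id rsym)
    with no show False by blast
  qed
  moreover have "\<not> z > M"
  proof
    assume "z > M"
    have "\<exists>B. is_inverse (z *\<^sub>R id_blinfun - A) B"
    proof (rule inverse_of_positive_bounded_below)
      show "z - M > 0" using \<open>z > M\<close> by simp
      show "(z - M) * (norm x)\<^sup>2 \<le> rip x ((z *\<^sub>R id_blinfun - A) x)" for x
        using M[of x] by (simp add: blinfun.bilinear_simps rip_linear rip_self algebra_simps)
    qed (intro rsymmetric_diff rsymmetric_scaleR rsymmetric_id rsym)
    then obtain B where "is_inverse (z *\<^sub>R id_blinfun - A) B" by blast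
    from is_inverse_scaleR[OF this, of "-1"] no show False by simp
  qed
  ultimately show "z \<in> {m..M}" by simp
qed

text \<open>One of \<open>\<plusminus> norm A\<close> is in the spectrum of a nonzero \<open>A\<close>; and \<open>0\<close> is in the spectrum of the zero operator,
  unless the space is trivial.\<close>

lemma rspec_nonempty:
  fixes A :: "'a::complex_hilbert \<Rightarrow>\<^sub>L 'a"
  assumes A: "self_adjoint A" and empty: "rspec A = {}"
  shows "(id_blinfun :: 'a \<Rightarrow>\<^sub>L 'a) = 0"
proof -
  have all: "\<exists>B. is_inverse (A - z *\<^sub>R id_blinfun) B" for z
    using empty rspec_iff[of A z] A by (auto simp: self_adjointD)
  obtain B B' where BB': "is_inverse (A - norm A *\<^sub>R id_blinfun) B" "is_inverse (A - (- norm A) *\<^sub>R id_blinfun) B'"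
    using all by metis
  have "norm A = 0"
    using norm_is_spectral[OF self_adjointD(2)[OF A] refl _ BB'(1)] BB'(2) by fastforce
  then have "A = 0" by simp
  with all[of 0] show ?thesis by (auto simp: is_inverse_def)
qed

section \<open>Real polynomials of a self-adjoint operator\<close>

lemma op_poly_bound:
  assumes "degree p \<le> n"
  shows "op_poly p A = (\<Sum>i\<le>n. coeff p i *\<^sub>R ((\<lambda>B. A o\<^sub>L B) ^^ i) id_blinfun)"
  unfolding op_poly_def
  by (rule sum.mono_neutral_left) (use assms in \<open>auto simp: coeff_eq_0\<close>)

lemma op_poly_0 [simp]: "op_poly 0 A = 0"
  by (simp add: op_poly_def)

lemma op_poly_pCons: "op_poly (pCons a p) A = a *\<^sub>R id_blinfun + (A o\<^sub>L op_poly p A)"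
proof -
  have "op_poly (pCons a p) A
      = (\<Sum>i\<le>Suc (degree p). coeff (pCons a p) i *\<^sub>R ((\<lambda>B. A o\<^sub>L B) ^^ i) id_blinfun)"
    by (rule op_poly_bound) (simp add: degree_pCons_le)
  also have "\<dots> = a *\<^sub>R id_blinfun + (A o\<^sub>L op_poly p A)"
    unfolding op_poly_def
    by (subst sum.atMost_Suc_shift) (simp add: compose.sum_right compose.scaleR_right)
  finally show ?thesis .
qed

lemma op_poly_add: "op_poly (p + q) A = op_poly p A + op_poly q A"
proof -
  let ?n = "max (degree p) (degree q)"
  show ?thesis
    using op_poly_bound[of p ?n A] op_poly_bound[of q ?n A] op_poly_bound[of "p + q" ?n A]
    by (simp add: degree_add_le_max scaleR_add_left sum.distrib)
qed

lemma op_poly_smult: "op_poly (smult c p) A = c *\<^sub>R op_poly p A"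
  using op_poly_bound[of "smult c p" "degree p" A]
  by (simp add: op_poly_def scaleR_sum_right degree_smult_le)

lemma op_poly_diff: "op_poly (p - q) A = op_poly p A - op_poly q A"
  using op_poly_add[of p "smult (-1) q" A] unfolding op_poly_smult by simp

lemma op_poly_mult: "op_poly (p * q) A = op_poly p A o\<^sub>L op_poly q A"
  by (induction p)
     (simp_all add: op_poly_add op_poly_smult op_poly_pCons compose_linear compose_assoc)

lemma op_poly_const: "op_poly [:c:] A = c *\<^sub>R id_blinfun"
  by (simp add: op_poly_pCons)

lemma op_poly_X: "op_poly [:0, 1:] A = A"
  by (simp add: op_poly_pCons)

text \<open>With \<open>Z = A\<close> and \<open>B = A\<close> this is commutation; the general form is what makes functional calculus
  compatible with unitary equivalence.\<close>

lemma op_poly_intertwine: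
  assumes "Z o\<^sub>L A = B o\<^sub>L Z"
  shows "Z o\<^sub>L op_poly p A = op_poly p B o\<^sub>L Z"
proof (induction p)
  case (pCons a p)
  have "Z o\<^sub>L (A o\<^sub>L op_poly p A) = B o\<^sub>L (Z o\<^sub>L op_poly p A)"
    using assms by (metis compose_assoc)
  also have "\<dots> = B o\<^sub>L op_poly p B o\<^sub>L Z" by (simp add: pCons compose_assoc)
  finally show ?case by (simp add: op_poly_pCons compose_linear)
qed simp

lemma op_poly_self_adjoint:
  assumes "self_adjoint A"
  shows "self_adjoint (op_poly p A)"
proof (induction p)
  case 0
  show ?case using self_adjoint_scaleR[OF assms, of 0] by simp
next
  case (pCons a p)
  have "A o\<^sub>L op_poly p A = op_poly p A o\<^sub>L A"
    by (rule op_poly_intertwine) simp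
  with pCons assms show ?case
    unfolding op_poly_pCons by (intro self_adjoint_intros self_adjoint_compose)
qed

lemma map_poly_of_real_add:
  "map_poly complex_of_real (p + q) = map_poly complex_of_real p + map_poly complex_of_real q"
  by (rule poly_eqI) (simp add: coeff_map_poly)

lemma map_poly_of_real_mult:
  "map_poly complex_of_real (p * q) = map_poly complex_of_real p * map_poly complex_of_real q"
  by (rule poly_eqI) (simp add: coeff_map_poly coeff_mult)

lemma poly_map_poly_of_real: "poly (map_poly complex_of_real p) (of_real x) = of_real (poly p x)"
  by (induction p) (simp_all add: map_poly_pCons)

text \<open>Spectral mapping, in the direction that is needed: split off the real roots of \<open>p\<close>, which lie
  outside the spectrum, and the quadratic factors \<open>(X - a)\<^sup>2 + b\<^sup>2\<close> of conjugate pairs of roots,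
  which give operators bounded below by \<open>b\<^sup>2\<close>.\<close>

lemma op_poly_invertible:
  assumes A: "self_adjoint A"
  shows "p \<noteq> 0 \<Longrightarrow> (\<And>x. x \<in> rspec A \<Longrightarrow> poly p x \<noteq> 0) \<Longrightarrow> \<exists>B. is_inverse (op_poly p A) B"
proof (induction "degree p" arbitrary: p rule: less_induct)
  case less
  have split: "\<exists>B. is_inverse (op_poly p A) B"
    if p: "p = d * q" and d: "degree d > 0" "\<exists>B. is_inverse (op_poly d A) B" for d q
  proof -
    have "q \<noteq> 0" "d \<noteq> 0" using p less.prems by auto
    moreover have "degree q < degree p"
      using d \<open>q \<noteq> 0\<close> \<open>d \<noteq> 0\<close> by (simp add: p degree_mult_eq)
    ultimately have "\<exists>B. is_inverse (op_poly q A) B"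
      using less.prems(2) by (intro less.hyps) (auto simp: p)
    with d(2) show ?thesis
      unfolding p op_poly_mult using is_inverse_compose by blast
  qed
  show ?case
  proof (cases "degree p = 0")
    case True
    then obtain c where c: "p = [:c:]" by (rule degree_eq_zeroE)
    with less.prems have "is_inverse (c *\<^sub>R id_blinfun) ((1 / c) *\<^sub>R id_blinfun)"
      by (intro is_inverse_scaleR) (auto simp: is_inverse_def)
    then show ?thesis by (auto simp: c op_poly_const)
  next
    case False
    let ?p = "map_poly complex_of_real p"
    have "\<not> constant (poly ?p)"
      using False by (simp add: constant_degree degree_map_poly)
    then obtain z where z: "poly ?p z = 0" using fundamental_theorem_of_algebra by blast
    show ?thesis
    proof (cases "Im z = 0")
      case True
      then have "complex_of_real (poly p (Re z)) = 0"
        using z complex_is_Real_iff[of z] by (metis of_real_Re poly_map_poly_of_real)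
      then have root: "poly p (Re z) = 0" by simp
      then obtain q where q: "p = [:- Re z, 1:] * q" by (metis dvdE poly_eq_0_iff_dvd)
      have "Re z \<notin> rspec A" using root less.prems by blast
      then have "\<exists>B. is_inverse (op_poly [:- Re z, 1:] A) B"
        using rspec_iff[of A "Re z"] A by (auto simp: self_adjointD op_poly_pCons)
      then show ?thesis by (intro split[OF q]) auto
    next
      case nonreal: False
      define d where "d = [:(Re z)\<^sup>2 + (Im z)\<^sup>2, - 2 * Re z, 1:]"
      have d0: "poly (map_poly complex_of_real d) z = 0"
        by (simp add: d_def map_poly_pCons complex_eq_iff power2_eq_square algebra_simps)
      have dd: "degree d = 2" by (simp add: d_def)
      define r where "r = p mod d"
      have "degree r < 2"
        using degree_mod_less[of d p] dd unfolding r_def by (cases "d = 0") (auto simp: d_def)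
      then have "coeff r i = 0" if "i \<ge> 2" for i using that by (intro coeff_eq_0) simp
      then have r: "r = [:coeff r 0, coeff r 1:]"
        by (intro poly_eqI) (auto simp: coeff_pCons split: nat.split)
      \<comment> \<open>A real polynomial of degree at most one with the nonreal root \<open>z\<close> vanishes, so \<open>d\<close> divides \<open>p\<close>.\<close>
      have "p = (p div d) * d + r" by (simp add: r_def)
      then have "?p = map_poly complex_of_real (p div d) * map_poly complex_of_real d + map_poly complex_of_real r"
        by (metis map_poly_of_real_add map_poly_of_real_mult)
      then have "poly (map_poly complex_of_real r) z = 0" using z d0 by simp
      then have "of_real (coeff r 0) + z * of_real (coeff r 1) = (0::complex)"
        by (subst (asm) r) (simp add: map_poly_pCons)
      then have "Im z * coeff r 1 = 0" "coeff r 0 + Re z * coeff r 1 = 0"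
        by (auto simp: complex_eq_iff)
      then have "r = 0" using nonreal r by auto
      then have q: "p = d * (p div d)" using \<open>p = (p div d) * d + r\<close> by (simp add: mult.commute)
      define H where "H = A - Re z *\<^sub>R id_blinfun"
      have H: "rsymmetric H"
        unfolding H_def using A by (intro rsymmetric_diff rsymmetric_scaleR rsymmetric_id self_adjointD)
      have dA: "op_poly d A = (H o\<^sub>L H) + (Im z)\<^sup>2 *\<^sub>R id_blinfun"
        unfolding d_def H_def by (simp add: op_poly_pCons compose_linear algebra_simps power2_eq_square)
          (simp flip: scaleR_add_left)
      have "\<exists>B. is_inverse (op_poly d A) B"
      proof (rule inverse_of_positive_bounded_below)
        show "rsymmetric (op_poly d A)" using op_poly_self_adjoint[OF A] by (rule self_adjointD)
        show "(Im z)\<^sup>2 > 0" using nonreal by simp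
        show "(Im z)\<^sup>2 * (norm x)\<^sup>2 \<le> rip x (op_poly d A x)" for x
          unfolding dA using rsymmetricD[OF H, of x "H x"] zero_le_power2[of "norm (H x)"]
          by (simp add: blinfun.bilinear_simps rip_linear rip_self)
      qed
      then show ?thesis by (intro split[OF q]) (auto simp: dd)
    qed
  qed
qed

text \<open>The norm \<open>N\<close> of the self-adjoint operator \<open>p(A)\<close> is, up to sign, in its spectrum, and hence by
  spectral mapping \<open>\<bar>p\<bar>\<close> takes the value \<open>N\<close> on the spectrum of \<open>A\<close>.\<close>

lemma norm_op_poly_le:
  fixes A :: "'a::complex_hilbert \<Rightarrow>\<^sub>L 'a"
  assumes A: "self_adjoint A" and c: "0 \<le> c" and bound: "\<And>x. x \<in> rspec A \<Longrightarrow> \<bar>poly p x\<bar> \<le> c"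
  shows "norm (op_poly p A) \<le> c"
proof (rule ccontr)
  define N where "N = norm (op_poly p A)"
  assume "\<not> norm (op_poly p A) \<le> c"
  then have N: "c < N" by (simp add: N_def)
  have nonempty: "rspec A \<noteq> {}"
  proof
    assume "rspec A = {}"
    then have "(id_blinfun :: 'a \<Rightarrow>\<^sub>L 'a) = 0" by (rule rspec_nonempty[OF A])
    then have "op_poly p A = 0" by (metis compose_id(1) compose.zero_left)
    then show False using N c by (simp add: N_def)
  qed
  have inv: "\<exists>B. is_inverse (op_poly p A - s *\<^sub>R id_blinfun) B" if s: "\<bar>s\<bar> = N" for s
  proof -
    have ne: "poly (p - [:s:]) x \<noteq> 0" if "x \<in> rspec A" for x
      using bound[OF that] s N by auto
    with nonempty have "p - [:s:] \<noteq> 0" by (metis ex_in_conv poly_0)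
    from op_poly_invertible[OF A this ne] show ?thesis
      by (simp add: op_poly_diff op_poly_const)
  qed
  obtain B B' where "is_inverse (op_poly p A - N *\<^sub>R id_blinfun) B"
    "is_inverse (op_poly p A - (- N) *\<^sub>R id_blinfun) B'"
    using inv[of N] inv[of "- N"] N c by auto
  then show False
    using norm_is_spectral[OF self_adjointD(2)[OF op_poly_self_adjoint[OF A]] N_def] N c by simp
qed

section \<open>The continuous functional calculus\<close>

lemma polynomial_approximation:
  fixes f :: "real \<Rightarrow> real"
  assumes "continuous_on {m..M} f"
  obtains p where "uniform_limit {m..M} (\<lambda>n. poly (p n)) f sequentially"
proof -
  obtain g where g: "uniform_limit {m..M} g f sequentially" "\<And>n. polynomial_function (g n)"
    using Stone_Weierstrass_uniform_limit[OF compact_Icc assms] by blast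
  have "\<exists>p. g n = poly p" for n
  proof -
    have "real_polynomial_function (g n)"
      using g(2) by (simp add: real_polynomial_function_eq)
    then obtain a N where "g n = (\<lambda>x. \<Sum>i\<le>N. a i * x ^ i)"
      by (auto simp: real_polynomial_function_iff_sum)
    then have "g n = poly (\<Sum>i\<le>N. monom (a i) i)"
      by (auto simp: poly_sum poly_monom)
    then show ?thesis by blast
  qed
  then obtain p where "\<And>n. g n = poly (p n)" by metis
  then have "g = (\<lambda>n. poly (p n))" by (rule ext)
  with g(1) show ?thesis by (intro that) simp
qed

lemma poly_diff_fun: "poly (p - q) = (\<lambda>x::real. poly p x - poly q x)"
  and poly_mult_fun: "poly (p * q) = (\<lambda>x::real. poly p x * poly q x)"
  by auto

text \<open>Two operators have different spectra, but a common interval contains both; working with continuous functions on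
  an interval lets one polynomial approximation serve several operators at once.\<close>

definition spectrum_within :: "('a::complex_hilbert \<Rightarrow>\<^sub>L 'a) \<Rightarrow> real \<Rightarrow> real \<Rightarrow> bool" where
  "spectrum_within A m M \<longleftrightarrow> self_adjoint A \<and> rspec A \<subseteq> {m..M}"

lemma spectrum_within_self_adjoint: "spectrum_within A m M \<Longrightarrow> self_adjoint A"
  by (simp add: spectrum_within_def)

lemma spectrum_within_mono:
  "spectrum_within A m M \<Longrightarrow> m' \<le> m \<Longrightarrow> M \<le> M' \<Longrightarrow> spectrum_within A m' M'"
  by (fastforce simp: spectrum_within_def)

lemma op_poly_null_sequence:
  assumes A: "self_adjoint A" and lim: "uniform_limit (rspec A) (\<lambda>n. poly (r n)) (\<lambda>_. 0) sequentially"
  shows "(\<lambda>n. op_poly (r n) A) \<longlonglongrightarrow> 0"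
proof (rule LIMSEQ_I)
  fix e :: real assume e: "e > 0"
  then have "\<forall>\<^sub>F n in sequentially. \<forall>x\<in>rspec A. dist (poly (r n) x) 0 < e / 2"
    by (intro uniform_limitD[OF lim]) simp
  then obtain N where N: "\<And>n x. n \<ge> N \<Longrightarrow> x \<in> rspec A \<Longrightarrow> \<bar>poly (r n) x\<bar> < e / 2"
    unfolding eventually_sequentially by auto
  have "norm (op_poly (r n) A - 0) < e" if "n \<ge> N" for n
  proof -
    have "norm (op_poly (r n) A) \<le> e / 2"
      using e N[OF that] by (intro norm_op_poly_le[OF A]) (auto intro: less_imp_le)
    then show ?thesis using e by simp
  qed
  then show "\<exists>N. \<forall>n\<ge>N. norm (op_poly (r n) A - 0) < e" by blast
qed

lemma op_poly_convergent:
  assumes A: "self_adjoint A" and lim: "uniform_limit (rspec A) (\<lambda>n. poly (q n)) f sequentially"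
  shows "\<exists>B. (\<lambda>n. op_poly (q n) A) \<longlonglongrightarrow> B"
proof -
  have "Cauchy (\<lambda>n. op_poly (q n) A)"
  proof (rule metric_CauchyI)
    fix e :: real assume e: "e > 0"
    then have "\<forall>\<^sub>F n in sequentially. \<forall>x\<in>rspec A. dist (poly (q n) x) (f x) < e / 4"
      by (intro uniform_limitD[OF lim]) simp
    then obtain N where N: "\<And>n x. n \<ge> N \<Longrightarrow> x \<in> rspec A \<Longrightarrow> \<bar>poly (q n) x - f x\<bar> < e / 4"
      unfolding eventually_sequentially by (auto simp: dist_real_def)
    have "dist (op_poly (q i) A) (op_poly (q j) A) < e" if "i \<ge> N" "j \<ge> N" for i j
    proof -
      have "norm (op_poly (q i - q j) A) \<le> e / 2"
      proof (rule norm_op_poly_le[OF A])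
        show "\<bar>poly (q i - q j) x\<bar> \<le> e / 2" if "x \<in> rspec A" for x
          using N[OF \<open>i \<ge> N\<close> that] N[OF \<open>j \<ge> N\<close> that]
          unfolding poly_diff by linarith
      qed (use e in simp)
      then show ?thesis using e by (simp add: dist_norm op_poly_diff)
    qed
    then show "\<exists>N. \<forall>i\<ge>N. \<forall>j\<ge>N. dist (op_poly (q i) A) (op_poly (q j) A) < e" by blast
  qed
  then show ?thesis by (simp add: Cauchy_convergent_iff convergent_def)
qed

text \<open>The sequence converges because \<open>norm (q(A))\<close> is controlled by \<open>q\<close> on the spectrum; the same estimate shows
  that any other approximating sequence has the same limit, so the definite description denotes.\<close>

lemma op_fun_calc_LIMSEQ:
  assumes A: "spectrum_within A m M" and f: "continuous_on {m..M} f"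
    and p: "uniform_limit {m..M} (\<lambda>n. poly (p n)) f sequentially"
  shows "(\<lambda>n. op_poly (p n) A) \<longlonglongrightarrow> op_fun_calc f A"
proof -
  have sa: "self_adjoint A" and sub: "rspec A \<subseteq> {m..M}"
    using A by (auto simp: spectrum_within_def)
  have p': "uniform_limit (rspec A) (\<lambda>n. poly (p n)) f sequentially"
    using uniform_limit_on_subset[OF p sub] .
  then obtain B where B: "(\<lambda>n. op_poly (p n) A) \<longlonglongrightarrow> B"
    using op_poly_convergent[OF sa] by blast
  have "op_fun_calc f A = B"
    unfolding op_fun_calc_def rspec_def[symmetric]
  proof (rule the_equality)
    show "\<forall>q. uniform_limit (rspec A) (\<lambda>n. poly (q n)) f sequentially \<longrightarrow> (\<lambda>n. op_poly (q n) A) \<longlonglongrightarrow> B"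
    proof (intro allI impI)
      fix q :: "nat \<Rightarrow> real poly"
      assume q: "uniform_limit (rspec A) (\<lambda>n. poly (q n)) f sequentially"
      have "uniform_limit (rspec A) (\<lambda>n x. poly (q n) x - poly (p n) x) (\<lambda>x. f x - f x) sequentially"
        by (intro uniform_limit_intros q p')
      then have "(\<lambda>n. op_poly (q n - p n) A) \<longlonglongrightarrow> 0"
        by (intro op_poly_null_sequence[OF sa]) (simp add: poly_diff_fun)
      from tendsto_add[OF this B] show "(\<lambda>n. op_poly (q n) A) \<longlonglongrightarrow> B"
        by (simp add: op_poly_diff)
    qed
    show "B' = B" if "\<forall>q. uniform_limit (rspec A) (\<lambda>n. poly (q n)) f sequentially \<longrightarrow>
        (\<lambda>n. op_poly (q n) A) \<longlonglongrightarrow> B'" for B'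
      using that p' B LIMSEQ_unique by blast
  qed
  with B show ?thesis by simp
qed

lemma op_fun_calc_limit:
  assumes "spectrum_within A m M" "continuous_on {m..M} f"
  obtains p where "uniform_limit {m..M} (\<lambda>n. poly (p n)) f sequentially"
    "(\<lambda>n. op_poly (p n) A) \<longlonglongrightarrow> op_fun_calc f A"
  using polynomial_approximation[OF assms(2)] op_fun_calc_LIMSEQ[OF assms] by metis

lemma op_fun_calc_poly:
  assumes "spectrum_within A m M"
  shows "op_fun_calc (poly p) A = op_poly p A"
proof -
  have "(\<lambda>_::nat. op_poly p A) \<longlonglongrightarrow> op_fun_calc (poly p) A"
    by (intro op_fun_calc_LIMSEQ[OF assms] continuous_intros uniform_limit_const)
  then show ?thesis by (simp add: LIMSEQ_const_iff)
qed

lemma op_fun_calc_cong: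
  assumes "spectrum_within A m M" "\<And>x. x \<in> {m..M} \<Longrightarrow> f x = g x"
  shows "op_fun_calc f A = op_fun_calc g A"
proof -
  have "uniform_limit (rspec A) (\<lambda>n. poly (p n)) f sequentially \<longleftrightarrow>
    uniform_limit (rspec A) (\<lambda>n. poly (p n)) g sequentially" for p
    by (intro uniform_limit_cong') (use assms in \<open>auto simp: spectrum_within_def\<close>)
  then show ?thesis by (simp add: op_fun_calc_def flip: rspec_def)
qed

lemma op_fun_calc_const:
  assumes "spectrum_within A m M"
  shows "op_fun_calc (\<lambda>_. c) A = c *\<^sub>R id_blinfun"
proof -
  have "poly [:c:] = (\<lambda>_. c)" by (rule ext) simp
  with op_fun_calc_poly[OF assms, of "[:c:]"] show ?thesis by (simp add: op_poly_const)
qed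

lemma op_fun_calc_ident:
  assumes "spectrum_within A m M"
  shows "op_fun_calc (\<lambda>x. x) A = A"
proof -
  have "poly [:0, 1:] = (\<lambda>x::real. x)" by (rule ext) simp
  with op_fun_calc_poly[OF assms, of "[:0, 1:]"] show ?thesis by (simp add: op_poly_X)
qed

lemma op_fun_calc_intertwine:
  assumes A: "spectrum_within A m M" and B: "spectrum_within B m M" and f: "continuous_on {m..M} f"
    and Z: "Z o\<^sub>L A = B o\<^sub>L Z"
  shows "Z o\<^sub>L op_fun_calc f A = op_fun_calc f B o\<^sub>L Z"
proof -
  obtain p where p: "uniform_limit {m..M} (\<lambda>n. poly (p n)) f sequentially"
    using polynomial_approximation[OF f] .
  have "(\<lambda>n. Z o\<^sub>L op_poly (p n) A) \<longlonglongrightarrow> (Z o\<^sub>L op_fun_calc f A)"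
    by (intro compose.tendsto tendsto_const op_fun_calc_LIMSEQ[OF A f p])
  moreover have "(\<lambda>n. op_poly (p n) B o\<^sub>L Z) \<longlonglongrightarrow> (op_fun_calc f B o\<^sub>L Z)"
    by (intro compose.tendsto tendsto_const op_fun_calc_LIMSEQ[OF B f p])
  ultimately show ?thesis
    unfolding op_poly_intertwine[OF Z] by (rule LIMSEQ_unique)
qed

lemma op_fun_calc_self_adjoint:
  fixes A :: "'a::complex_hilbert \<Rightarrow>\<^sub>L 'a"
  assumes A: "spectrum_within A m M" and f: "continuous_on {m..M} f"
  shows "self_adjoint (op_fun_calc f A)"
proof -
  obtain p where p: "(\<lambda>n. op_poly (p n) A) \<longlonglongrightarrow> op_fun_calc f A"
    using op_fun_calc_limit[OF A f] by metis
  have lim: "(\<lambda>n. op_poly (p n) A x) \<longlonglongrightarrow> op_fun_calc f A x" for x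
    by (intro blinfun.tendsto tendsto_const p)
  have sa: "self_adjoint (op_poly (p n) A)" for n
    by (rule op_poly_self_adjoint[OF spectrum_within_self_adjoint[OF A]])
  have sym: "rip (op_fun_calc f A x) y = rip x (op_fun_calc f A y)" for x y
  proof (rule LIMSEQ_unique)
    show "(\<lambda>n. rip (op_poly (p n) A x) y) \<longlonglongrightarrow> rip (op_fun_calc f A x) y"
      by (rule bounded_linear.tendsto[OF bounded_linear_rip_left lim])
    show "(\<lambda>n. rip (op_poly (p n) A x) y) \<longlonglongrightarrow> rip x (op_fun_calc f A y)"
      unfolding self_adjointD(3)[OF sa]
      by (rule bounded_linear.tendsto[OF bounded_linear_rip lim])
  qed
  have "op_fun_calc f A (c *\<^sub>C x) = c *\<^sub>C op_fun_calc f A x" for c x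
  proof (rule rip_eqI)
    fix u
    have adj: "rip u (c *\<^sub>C y) = rip (cnj c *\<^sub>C u) y" for y :: 'a
    proof -
      have "cinner (cnj c *\<^sub>C u) y = cnj (cnj c * cinner y u)"
        by (metis cinner_commute cinner_scaleC_right)
      also have "\<dots> = cinner u (c *\<^sub>C y)"
        by (metis cinner_commute cinner_scaleC_right complex_cnj_cnj complex_cnj_mult)
      finally show ?thesis by (simp add: rip_def)
    qed
    show "rip u (op_fun_calc f A (c *\<^sub>C x)) = rip u (c *\<^sub>C op_fun_calc f A x)"
    proof (rule LIMSEQ_unique)
      show "(\<lambda>n. rip u (op_poly (p n) A (c *\<^sub>C x))) \<longlonglongrightarrow> rip u (op_fun_calc f A (c *\<^sub>C x))"
        by (rule bounded_linear.tendsto[OF bounded_linear_rip lim])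
      show "(\<lambda>n. rip u (op_poly (p n) A (c *\<^sub>C x))) \<longlonglongrightarrow> rip u (c *\<^sub>C op_fun_calc f A x)"
        unfolding clinear_opD[OF self_adjointD(1)[OF sa]] adj
        by (rule bounded_linear.tendsto[OF bounded_linear_rip lim])
    qed
  qed
  with sym show ?thesis by (simp add: self_adjoint_def clinear_op_def rsymmetric_def)
qed

lemma bounded_image_Icc:
  fixes f :: "real \<Rightarrow> real"
  assumes "continuous_on {m..M} f"
  shows "bounded (f ` {m..M})"
  by (intro compact_imp_bounded compact_continuous_image assms compact_Icc)

lemma op_fun_calc_mult:
  assumes A: "spectrum_within A m M" and f: "continuous_on {m..M} f" and g: "continuous_on {m..M} g"
  shows "op_fun_calc (\<lambda>x. f x * g x) A = op_fun_calc f A o\<^sub>L op_fun_calc g A"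
proof -
  obtain p where p: "uniform_limit {m..M} (\<lambda>n. poly (p n)) f sequentially"
    "(\<lambda>n. op_poly (p n) A) \<longlonglongrightarrow> op_fun_calc f A" using op_fun_calc_limit[OF A f] .
  obtain q where q: "uniform_limit {m..M} (\<lambda>n. poly (q n)) g sequentially"
    "(\<lambda>n. op_poly (q n) A) \<longlonglongrightarrow> op_fun_calc g A" using op_fun_calc_limit[OF A g] .
  have "uniform_limit {m..M} (\<lambda>n x. poly (p n) x * poly (q n) x) (\<lambda>x. f x * g x) sequentially"
    by (intro uniform_lim_mult p q bounded_image_Icc f g)
  then have "(\<lambda>n. op_poly (p n * q n) A) \<longlonglongrightarrow> op_fun_calc (\<lambda>x. f x * g x) A"
    by (intro op_fun_calc_LIMSEQ[OF A] continuous_intros f g) (simp add: poly_mult_fun)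
  moreover have "(\<lambda>n. op_poly (p n * q n) A) \<longlonglongrightarrow> (op_fun_calc f A o\<^sub>L op_fun_calc g A)"
    unfolding op_poly_mult by (intro compose.tendsto p q)
  ultimately show ?thesis by (rule LIMSEQ_unique)
qed

lemma op_fun_calc_diff:
  assumes A: "spectrum_within A m M" and f: "continuous_on {m..M} f" and g: "continuous_on {m..M} g"
  shows "op_fun_calc (\<lambda>x. f x - g x) A = op_fun_calc f A - op_fun_calc g A"
proof -
  obtain p where p: "uniform_limit {m..M} (\<lambda>n. poly (p n)) f sequentially"
    "(\<lambda>n. op_poly (p n) A) \<longlonglongrightarrow> op_fun_calc f A" using op_fun_calc_limit[OF A f] .
  obtain q where q: "uniform_limit {m..M} (\<lambda>n. poly (q n)) g sequentially"
    "(\<lambda>n. op_poly (q n) A) \<longlonglongrightarrow> op_fun_calc g A" using op_fun_calc_limit[OF A g] .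
  have "uniform_limit {m..M} (\<lambda>n x. poly (p n) x - poly (q n) x) (\<lambda>x. f x - g x) sequentially"
    by (intro uniform_limit_intros p q)
  then have "(\<lambda>n. op_poly (p n - q n) A) \<longlonglongrightarrow> op_fun_calc (\<lambda>x. f x - g x) A"
    by (intro op_fun_calc_LIMSEQ[OF A] continuous_intros f g) (simp add: poly_diff_fun)
  moreover have "(\<lambda>n. op_poly (p n - q n) A) \<longlonglongrightarrow> op_fun_calc f A - op_fun_calc g A"
    unfolding op_poly_diff by (intro tendsto_diff p q)
  ultimately show ?thesis by (rule LIMSEQ_unique)
qed

text \<open>A nonnegative function is a square, and the square of a self-adjoint operator is positive.\<close>

lemma op_fun_calc_positive:
  assumes A: "spectrum_within A m M" and f: "continuous_on {m..M} f"
    and nonneg: "\<And>x. x \<in> {m..M} \<Longrightarrow> 0 \<le> f x"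
  shows "op_positive (op_fun_calc f A)"
proof -
  have s: "continuous_on {m..M} (\<lambda>x. sqrt (f x))" by (intro continuous_intros f)
  have "op_fun_calc f A = op_fun_calc (\<lambda>x. sqrt (f x) * sqrt (f x)) A"
    by (rule op_fun_calc_cong[OF A]) (simp add: nonneg)
  also have "\<dots> = op_fun_calc (\<lambda>x. sqrt (f x)) A o\<^sub>L op_fun_calc (\<lambda>x. sqrt (f x)) A" (is "_ = ?R o\<^sub>L ?R")
    by (rule op_fun_calc_mult[OF A s s])
  finally have eq: "op_fun_calc f A = ?R o\<^sub>L ?R" .
  have "rip x (op_fun_calc f A x) = (norm (?R x))\<^sup>2" for x
    using self_adjointD(3)[OF op_fun_calc_self_adjoint[OF A s], of x "?R x"] by (simp add: eq rip_self)
  then show ?thesis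
    using op_fun_calc_self_adjoint[OF A f] by (simp add: op_positive_iff)
qed

lemma norm_op_fun_calc_le:
  assumes A: "spectrum_within A m M" and f: "continuous_on {m..M} f"
    and c: "0 \<le> c" "\<And>x. x \<in> {m..M} \<Longrightarrow> \<bar>f x\<bar> \<le> c"
  shows "norm (op_fun_calc f A) \<le> c"
proof (rule field_le_epsilon)
  fix e :: real assume e: "e > 0"
  obtain p where p: "uniform_limit {m..M} (\<lambda>n. poly (p n)) f sequentially"
    "(\<lambda>n. op_poly (p n) A) \<longlonglongrightarrow> op_fun_calc f A" using op_fun_calc_limit[OF A f] .
  have sa: "self_adjoint A" and sub: "rspec A \<subseteq> {m..M}"
    using A by (auto simp: spectrum_within_def)
  have "\<forall>\<^sub>F n in sequentially. \<forall>x\<in>{m..M}. dist (poly (p n) x) (f x) < e"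
    using p(1) e unfolding uniform_limit_iff by blast
  then have "\<forall>\<^sub>F n in sequentially. norm (op_poly (p n) A) \<le> c + e"
  proof eventually_elim
    case (elim n)
    show ?case
    proof (rule norm_op_poly_le[OF sa])
      fix x assume "x \<in> rspec A"
      then have "x \<in> {m..M}" using sub by blast
      then show "\<bar>poly (p n) x\<bar> \<le> c + e"
        using elim c(2)[of x] by (force simp: dist_real_def)
    qed (use c e in simp)
  qed
  then show "norm (op_fun_calc f A) \<le> c + e"
    using tendsto_upperbound[OF tendsto_norm[OF p(2)]] by simp
qed

text \<open>If \<open>\<lambda>\<close> is not a value of \<open>g\<close>, then \<open>1 / (g - \<lambda>)\<close> supplies the inverse of \<open>g(A) - \<lambda>\<close>.\<close>

lemma spectrum_within_op_fun_calc:
  assumes A: "spectrum_within A m M" and g: "continuous_on {m..M} g"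
    and range: "\<And>x. x \<in> {m..M} \<Longrightarrow> g x \<in> {m'..M'}"
  shows "spectrum_within (op_fun_calc g A) m' M'"
proof -
  have sa: "self_adjoint (op_fun_calc g A)" by (rule op_fun_calc_self_adjoint[OF A g])
  have "z \<in> {m'..M'}" if z: "z \<in> rspec (op_fun_calc g A)" for z
  proof (rule ccontr)
    assume out: "z \<notin> {m'..M'}"
    then have ne: "g x - z \<noteq> 0" if "x \<in> {m..M}" for x using range[OF that] by auto
    have c: "continuous_on {m..M} (\<lambda>x. g x - z)" "continuous_on {m..M} (\<lambda>x. 1 / (g x - z))"
      using ne by (auto intro!: continuous_intros g)
    let ?B = "op_fun_calc (\<lambda>x. 1 / (g x - z)) A"
    have gz: "op_fun_calc (\<lambda>x. g x - z) A = op_fun_calc g A - z *\<^sub>R id_blinfun"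
      by (simp add: op_fun_calc_diff[OF A g continuous_on_const] op_fun_calc_const[OF A])
    have "op_fun_calc (\<lambda>x. (g x - z) * (1 / (g x - z))) A = op_fun_calc (\<lambda>_. 1) A"
      "op_fun_calc (\<lambda>x. (1 / (g x - z)) * (g x - z)) A = op_fun_calc (\<lambda>_. 1) A"
      by (intro op_fun_calc_cong[OF A]; use ne in simp)+
    then have "is_inverse (op_fun_calc g A - z *\<^sub>R id_blinfun) ?B"
      unfolding op_fun_calc_mult[OF A c] op_fun_calc_mult[OF A c(2,1)] gz
      by (simp add: is_inverse_def op_fun_calc_const[OF A])
    with z show False
      using rspec_iff[OF self_adjointD(1)[OF sa]] by blast
  qed
  with sa show ?thesis by (auto simp: spectrum_within_def)
qed

text \<open>For polynomial \<open>f\<close> this is the homomorphism property; in general, approximate \<open>f\<close> by polynomials on an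
  interval containing the values of \<open>g\<close>, which also contains the spectrum of \<open>g(A)\<close>.\<close>

lemma op_fun_calc_compose:
  assumes A: "spectrum_within A m M" and g: "continuous_on {m..M} g"
    and range: "\<And>x. x \<in> {m..M} \<Longrightarrow> g x \<in> {m'..M'}"
    and f: "continuous_on {m'..M'} f"
  shows "op_fun_calc f (op_fun_calc g A) = op_fun_calc (\<lambda>x. f (g x)) A"
proof -
  note B = spectrum_within_op_fun_calc[OF A g range]
  have fg: "continuous_on {m..M} (\<lambda>x. f (g x))"
    by (rule continuous_on_compose2[OF f g]) (use range in auto)
  have poly_case: "op_poly p (op_fun_calc g A) = op_fun_calc (\<lambda>x. poly p (g x)) A" for p
  proof (induction p)
    case 0
    show ?case using op_fun_calc_const[OF A, of 0] by simp
  next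
    case (pCons a p)
    have pg: "continuous_on {m..M} (\<lambda>x. poly p (g x))" by (intro continuous_intros g)
    have "op_fun_calc (\<lambda>x. poly (pCons a p) (g x)) A
        = op_fun_calc (\<lambda>x. g x * poly p (g x) - (- a)) A"
      by (simp add: add.commute)
    also have "\<dots> = op_fun_calc (\<lambda>x. g x * poly p (g x)) A - (- a) *\<^sub>R id_blinfun"
      by (subst op_fun_calc_diff[OF A]) (auto intro!: continuous_intros g simp: op_fun_calc_const[OF A])
    also have "\<dots> = a *\<^sub>R id_blinfun + (op_fun_calc g A o\<^sub>L op_poly p (op_fun_calc g A))"
      by (simp add: op_fun_calc_mult[OF A g pg] pCons)
    finally show ?case by (simp add: op_poly_pCons)
  qed
  obtain p where p: "uniform_limit {m'..M'} (\<lambda>n. poly (p n)) f sequentially"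
    "(\<lambda>n. op_poly (p n) (op_fun_calc g A)) \<longlonglongrightarrow> op_fun_calc f (op_fun_calc g A)"
    using op_fun_calc_limit[OF B f] by blast
  have "(\<lambda>n. op_fun_calc (\<lambda>x. poly (p n) (g x)) A) \<longlonglongrightarrow> op_fun_calc (\<lambda>x. f (g x)) A"
  proof (rule LIMSEQ_I)
    fix e :: real assume e: "e > 0"
    have "\<forall>\<^sub>F n in sequentially. \<forall>x\<in>{m'..M'}. dist (poly (p n) x) (f x) < e / 2"
      using e by (intro uniform_limitD[OF p(1)]) simp
    then obtain N where N: "\<And>n x. n \<ge> N \<Longrightarrow> x \<in> {m'..M'} \<Longrightarrow> \<bar>poly (p n) x - f x\<bar> < e / 2"
      unfolding eventually_sequentially dist_real_def by blast
    have "norm (op_fun_calc (\<lambda>x. poly (p n) (g x)) A - op_fun_calc (\<lambda>x. f (g x)) A) < e" if "n \<ge> N" for n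
    proof -
      have pg: "continuous_on {m..M} (\<lambda>x. poly (p n) (g x))" by (intro continuous_intros g)
      have "norm (op_fun_calc (\<lambda>x. poly (p n) (g x) - f (g x)) A) \<le> e / 2"
        using e N[OF that range]
        by (intro norm_op_fun_calc_le[OF A continuous_on_diff[OF pg fg]]) (auto intro: less_imp_le)
      then show ?thesis using e by (simp add: op_fun_calc_diff[OF A pg fg])
    qed
    then show "\<exists>N. \<forall>n\<ge>N. norm (op_fun_calc (\<lambda>x. poly (p n) (g x)) A - op_fun_calc (\<lambda>x. f (g x)) A) < e"
      by blast
  qed
  with p(2) show ?thesis unfolding poly_case by (rule LIMSEQ_unique)
qed

section \<open>Real powers of positive invertible operators\<close>

lemma pos_invertible_iff:
  "A \<in> pos_invertible_ops \<longleftrightarrow> self_adjoint A \<and> (\<forall>x. 0 \<le> rip x (A x)) \<and> (\<exists>B. is_inverse A B)"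
  by (auto simp: pos_invertible_ops_def op_positive_iff op_invertible_iff self_adjointD)

text \<open>Invertibility bounds a positive operator away from zero, so the singularity at \<open>0\<close> of \<open>x powr r\<close> is avoided.\<close>

lemma pos_invertible_spectrum:
  assumes "A \<in> pos_invertible_ops"
  obtains m M where "0 < m" "m \<le> M" "spectrum_within A m M"
proof -
  obtain B where sa: "self_adjoint A" and pos: "\<And>x. 0 \<le> rip x (A x)" and B: "is_inverse A B"
    using assms by (auto simp: pos_invertible_iff)
  obtain m where m: "m > 0" "\<And>x. m * (norm x)\<^sup>2 \<le> rip x (A x)"
    using positive_inverse_bounded_below[OF self_adjointD(2)[OF sa] pos B] by blast
  define M where "M = max m (norm A)"
  have "rip x (A x) \<le> M * (norm x)\<^sup>2" for x
  proof -
    have "rip x (A x) \<le> norm x * norm (A x)" by (rule rip_le)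
    also have "\<dots> \<le> norm x * (norm A * norm x)" by (intro mult_left_mono norm_blinfun) simp
    also have "\<dots> = norm A * (norm x)\<^sup>2" by (simp add: power2_eq_square)
    also have "\<dots> \<le> M * (norm x)\<^sup>2" by (intro mult_right_mono) (simp_all add: M_def)
    finally show ?thesis .
  qed
  with m sa have "spectrum_within A m M"
    using rspec_within[of A m M] by (simp add: spectrum_within_def)
  with m show ?thesis by (intro that) (auto simp: M_def)
qed

lemma common_spectrum_interval:
  assumes "A \<in> pos_invertible_ops" "B \<in> pos_invertible_ops"
  obtains m M where "0 < m" "spectrum_within A m M" "spectrum_within B m M"
proof -
  obtain m M where 1: "0 < m" "spectrum_within A m M" using pos_invertible_spectrum[OF assms(1)] by blast
  obtain m' M' where 2: "0 < m'" "spectrum_within B m' M'" using pos_invertible_spectrum[OF assms(2)] by blast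
  show ?thesis
    by (rule that[of "min m m'" "max M M'"]) (use 1 2 in \<open>auto elim: spectrum_within_mono\<close>)
qed

lemma continuous_on_powr_Icc: "0 < m \<Longrightarrow> continuous_on {m..M} (\<lambda>x::real. x powr r)"
  by (intro continuous_intros) auto

lemma op_powr_positive:
  assumes "A \<in> pos_invertible_ops"
  shows "op_positive (op_powr A r)"
proof -
  obtain m M where m: "0 < m" and A: "spectrum_within A m M" using pos_invertible_spectrum[OF assms] by blast
  then show ?thesis
    unfolding op_powr_def by (intro op_fun_calc_positive[OF A continuous_on_powr_Icc]) auto
qed

lemma op_powr_self_adjoint: "A \<in> pos_invertible_ops \<Longrightarrow> self_adjoint (op_powr A r)"
  by (rule op_positiveD(1)[OF op_powr_positive])

lemma op_powr_add:
  assumes "A \<in> pos_invertible_ops"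
  shows "op_powr A (r + s) = op_powr A r o\<^sub>L op_powr A s"
proof -
  obtain m M where m: "0 < m" and A: "spectrum_within A m M" using pos_invertible_spectrum[OF assms] by blast
  show ?thesis
    unfolding op_powr_def powr_add
    by (intro op_fun_calc_mult[OF A] continuous_on_powr_Icc m)
qed

lemma op_powr_0:
  assumes "A \<in> pos_invertible_ops"
  shows "op_powr A 0 = id_blinfun"
proof -
  obtain m M where m: "0 < m" and A: "spectrum_within A m M" using pos_invertible_spectrum[OF assms] by blast
  have "op_powr A 0 = op_fun_calc (\<lambda>_. 1) A"
    unfolding op_powr_def by (rule op_fun_calc_cong[OF A]) (use m in auto)
  then show ?thesis by (simp add: op_fun_calc_const[OF A])
qed

lemma op_powr_1:
  assumes "A \<in> pos_invertible_ops"
  shows "op_powr A 1 = A"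
proof -
  obtain m M where m: "0 < m" and A: "spectrum_within A m M" using pos_invertible_spectrum[OF assms] by blast
  have "op_powr A 1 = op_fun_calc (\<lambda>x. x) A"
    unfolding op_powr_def by (rule op_fun_calc_cong[OF A]) (use m in auto)
  then show ?thesis by (simp add: op_fun_calc_ident[OF A])
qed

lemma is_inverse_op_powr:
  assumes "A \<in> pos_invertible_ops"
  shows "is_inverse (op_powr A r) (op_powr A (- r))"
  by (simp add: is_inverse_def op_powr_0[OF assms] flip: op_powr_add[OF assms])

lemma op_powr_pos_invertible: "A \<in> pos_invertible_ops \<Longrightarrow> op_powr A r \<in> pos_invertible_ops"
  using op_powr_positive[of A r] is_inverse_op_powr[of A r] by (auto simp: pos_invertible_iff op_positive_iff)

lemma op_inverse_eq_powr: "A \<in> pos_invertible_ops \<Longrightarrow> op_inverse A = op_powr A (- 1)"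
  using op_inverse_eq[OF is_inverse_op_powr[of A 1]] by (simp add: op_powr_1)

lemma op_powr_powr:
  assumes "A \<in> pos_invertible_ops"
  shows "op_powr (op_powr A r) s = op_powr A (r * s)"
proof -
  obtain m M where m: "0 < m" "m \<le> M" and A: "spectrum_within A m M" using pos_invertible_spectrum[OF assms] by blast
  define m' where "m' = min (m powr r) (M powr r)"
  define M' where "M' = max (m powr r) (M powr r)"
  have m': "0 < m'" using m by (simp add: m'_def)
  have range: "x powr r \<in> {m'..M'}" if "x \<in> {m..M}" for x
    using that m powr_mono2[of r m x] powr_mono2[of r x M] powr_mono2'[of r m x] powr_mono2'[of r x M]
    by (cases "r \<ge> 0") (auto simp: m'_def M'_def)
  have "op_powr (op_powr A r) s = op_fun_calc (\<lambda>x. (x powr r) powr s) A"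
    unfolding op_powr_def
    using continuous_on_powr_Icc[OF m(1)] continuous_on_powr_Icc[OF m']
    by (intro op_fun_calc_compose[OF A _ range])
  then show ?thesis by (simp add: op_powr_def powr_powr)
qed

lemma op_powr_apply:
  assumes "A \<in> pos_invertible_ops"
  shows "op_powr A r (op_powr A s x) = op_powr A (r + s) x"
  by (simp add: op_powr_add[OF assms])

lemma op_powr_intertwine:
  assumes "A \<in> pos_invertible_ops" "B \<in> pos_invertible_ops" "Z o\<^sub>L A = B o\<^sub>L Z"
  shows "Z o\<^sub>L op_powr A r = op_powr B r o\<^sub>L Z"
proof -
  obtain m M where m: "0 < m" and A: "spectrum_within A m M" and B: "spectrum_within B m M"
    using common_spectrum_interval[OF assms(1,2)] .
  show ?thesis
    unfolding op_powr_def by (rule op_fun_calc_intertwine[OF A B continuous_on_powr_Icc[OF m] assms(3)])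
qed

lemma scaleR_pos_invertible:
  assumes "A \<in> pos_invertible_ops" "0 < t"
  shows "t *\<^sub>R A \<in> pos_invertible_ops"
  using assms is_inverse_scaleR[of A _ t]
  by (fastforce simp: pos_invertible_iff blinfun.bilinear_simps rip_linear intro: self_adjoint_scaleR)

lemma op_powr_scaleR:
  assumes "A \<in> pos_invertible_ops" "0 < t"
  shows "op_powr (t *\<^sub>R A) r = (t powr r) *\<^sub>R op_powr A r"
proof -
  obtain m M where m: "0 < m" and A: "spectrum_within A m M" using pos_invertible_spectrum[OF assms(1)] by blast
  have tA: "op_fun_calc (\<lambda>x. t * x) A = t *\<^sub>R A"
    by (simp add: op_fun_calc_mult[OF A] op_fun_calc_const[OF A] op_fun_calc_ident[OF A]
        compose.scaleR_left)
  have "0 < t * m" using assms(2) m by simp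
  from continuous_on_powr_Icc[OF this]
  have "op_powr (t *\<^sub>R A) r = op_fun_calc (\<lambda>x. (t * x) powr r) A"
    unfolding op_powr_def tA[symmetric]
    by (intro op_fun_calc_compose[OF A, of _ "t * m" "t * M"])
       (use assms(2) in \<open>auto intro!: continuous_intros\<close>)
  also have "\<dots> = op_fun_calc (\<lambda>x. t powr r * x powr r) A"
    by (rule op_fun_calc_cong[OF A]) (use assms(2) m in \<open>simp add: powr_mult\<close>)
  also have "\<dots> = op_fun_calc (\<lambda>_. t powr r) A o\<^sub>L op_powr A r"
    unfolding op_powr_def by (intro op_fun_calc_mult[OF A] continuous_on_powr_Icc m continuous_intros)
  finally show ?thesis by (simp add: op_fun_calc_const[OF A] compose.scaleR_left)
qed

lemma congruence_pos_invertible: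
  assumes A: "A \<in> pos_invertible_ops" and C: "clinear_op C" "is_inverse C D" "is_adjoint C C'"
  shows "C' o\<^sub>L A o\<^sub>L C \<in> pos_invertible_ops"
proof -
  obtain B where sa: "self_adjoint A" and pos: "\<And>x. 0 \<le> rip x (A x)" and B: "is_inverse A B"
    using A by (auto simp: pos_invertible_iff)
  obtain D' where D': "is_adjoint D D'" by (rule adjoint_exists)
  have inv: "is_inverse C' D'" by (rule is_adjoint_inverse[OF C(3,2) D'])
  have form: "rip x (C' y) = rip (C x) y" for x y by (simp add: is_adjointD[OF C(3)])
  have form': "rip (C' x) y = rip x (C y)" for x y by (metis form rip_commute)
  have "self_adjoint (C' o\<^sub>L A o\<^sub>L C)"
    using sa C clinear_adjoint[OF C(3,1)]
    by (auto simp: self_adjoint_def rsymmetric_def form form' intro!: clinear_intros)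
  moreover have "is_inverse (C' o\<^sub>L A o\<^sub>L C) (D o\<^sub>L (B o\<^sub>L D'))"
    by (intro is_inverse_compose inv B C)
  ultimately show ?thesis
    using pos by (auto simp: pos_invertible_iff form)
qed

lemma sandwich_pos_invertible:
  assumes "S \<in> pos_invertible_ops" "A \<in> pos_invertible_ops"
  shows "S o\<^sub>L A o\<^sub>L S \<in> pos_invertible_ops"
  using assms(1) congruence_pos_invertible[OF assms(2), of S _ S]
  by (auto simp: pos_invertible_iff[of S] self_adjointD is_adjoint_self)

lemma pos_invertible_self_adjoint: "A \<in> pos_invertible_ops \<Longrightarrow> self_adjoint A"
  by (simp add: pos_invertible_iff)

section \<open>The Loewner--Heinz inequality\<close>

lemma sandwich_mono:
  assumes "self_adjoint S" "self_adjoint A" "self_adjoint B" "A \<le>\<^sub>L B"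
  shows "S o\<^sub>L A o\<^sub>L S \<le>\<^sub>L S o\<^sub>L B o\<^sub>L S"
proof -
  have "rip x (S y) = rip (S x) y" for x y using self_adjointD(3)[OF assms(1)] by simp
  with assms show ?thesis
    by (simp add: loewner_le_iff self_adjoint_intros)
qed

lemma inverse_shift_beyond_norm:
  fixes K :: "'a::complex_hilbert \<Rightarrow>\<^sub>L 'a"
  assumes "norm K < \<bar>z\<bar>"
  shows "\<exists>B. is_inverse (K - z *\<^sub>R id_blinfun) B"
proof -
  have z: "z \<noteq> 0" using assms norm_ge_zero[of K] by auto
  have "norm ((1 / z) *\<^sub>R K) < 1" using assms z by (simp add: field_simps)
  then obtain B where "is_inverse (id_blinfun - (1 / z) *\<^sub>R K) B" using Neumann_inverse by blast
  from is_inverse_scaleR[OF this, of "- z"] z show ?thesis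
    by (auto simp: scaleR_diff_right)
qed

text \<open>The bound concerns the spectral radius, which similarity does not change and which is the norm of
  a symmetric operator.\<close>

lemma norm_le_similar:
  assumes T: "rsymmetric T" and Z: "is_inverse Z Z'" and K: "norm (Z' o\<^sub>L T o\<^sub>L Z) \<le> c"
  shows "norm T \<le> c"
proof (rule ccontr)
  assume "\<not> norm T \<le> c"
  then have gt: "norm (Z' o\<^sub>L T o\<^sub>L Z) < norm T" using K by simp
  have inv: "\<exists>B. is_inverse (T - z *\<^sub>R id_blinfun) B" if "\<bar>z\<bar> = norm T" for z
  proof -
    have "norm (Z' o\<^sub>L T o\<^sub>L Z) < \<bar>z\<bar>" using gt that by simp
    then obtain B where "is_inverse ((Z' o\<^sub>L T o\<^sub>L Z) - z *\<^sub>R id_blinfun) B"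
      using inverse_shift_beyond_norm by blast
    then have "is_inverse (Z o\<^sub>L ((Z' o\<^sub>L T o\<^sub>L Z) - z *\<^sub>R id_blinfun) o\<^sub>L Z') (Z o\<^sub>L (B o\<^sub>L Z'))"
      by (intro is_inverse_compose Z is_inverse_sym[OF Z])
    moreover have "Z o\<^sub>L ((Z' o\<^sub>L T o\<^sub>L Z) - z *\<^sub>R id_blinfun) o\<^sub>L Z' = T - z *\<^sub>R id_blinfun"
      by (rule blinfun_eqI) (simp add: blinfun.bilinear_simps is_inverse_apply[OF Z])
    ultimately show ?thesis by auto
  qed
  obtain B B' where "is_inverse (T - norm T *\<^sub>R id_blinfun) B" "is_inverse (T - (- norm T) *\<^sub>R id_blinfun) B'"
    using inv[of "norm T"] inv[of "- norm T"] by auto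
  moreover have "norm T > 0" using gt norm_ge_zero[of "Z' o\<^sub>L T o\<^sub>L Z"] by linarith
  ultimately show False using norm_is_spectral[OF T refl] by simp
qed

lemma norm_op_powr_apply:
  assumes "A \<in> pos_invertible_ops"
  shows "(norm (op_powr A (s / 2) x))\<^sup>2 = rip x (op_powr A s x)"
  using self_adjointD(3)[OF op_powr_self_adjoint[OF assms], of "s / 2" x "op_powr A (s / 2) x"]
  by (simp add: rip_self op_powr_apply[OF assms])

lemma loewner_le_imp_contraction:
  assumes A: "A \<in> pos_invertible_ops" and B: "B \<in> pos_invertible_ops"
    and le: "op_powr A s \<le>\<^sub>L op_powr B s"
  shows "norm (op_powr A (s / 2) o\<^sub>L op_powr B (- s / 2)) \<le> 1"
proof (rule norm_blinfun_bound)
  fix x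
  let ?y = "op_powr B (- s / 2) x"
  have "(norm (op_powr A (s / 2) ?y))\<^sup>2 \<le> (norm (op_powr B (s / 2) ?y))\<^sup>2"
    using le by (simp add: norm_op_powr_apply A B loewner_le_iff op_powr_self_adjoint)
  also have "\<dots> = (norm x)\<^sup>2" by (simp add: op_powr_apply[OF B] op_powr_0[OF B])
  finally have "norm (op_powr A (s / 2) ?y) \<le> norm x" by (rule power2_le_imp_le) simp
  then show "norm ((op_powr A (s / 2) o\<^sub>L op_powr B (- s / 2)) x) \<le> 1 * norm x" by simp
qed simp

text \<open>Pedersen's argument: \<open>B\<^bsup>-u/2\<^esup> A\<^sup>u B\<^bsup>-u/2\<^esup>\<close> with \<open>u = (s + t) / 2\<close> is similar to
  \<open>(B\<^bsup>-s/2\<^esup> A\<^bsup>s/2\<^esup>) (A\<^bsup>t/2\<^esup> B\<^bsup>-t/2\<^esup>)\<close>, a product of two contractions.\<close>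

lemma Loewner_Heinz_midpoint:
  assumes A: "A \<in> pos_invertible_ops" and B: "B \<in> pos_invertible_ops"
    and s: "op_powr A s \<le>\<^sub>L op_powr B s" and t: "op_powr A t \<le>\<^sub>L op_powr B t"
  shows "op_powr A ((s + t) / 2) \<le>\<^sub>L op_powr B ((s + t) / 2)"
proof -
  define u where "u = (s + t) / 2"
  define T where "T = op_powr B (- u / 2) o\<^sub>L op_powr A u o\<^sub>L op_powr B (- u / 2)"
  define Z where "Z = op_powr B ((s - t) / 4)"
  define Z' where "Z' = op_powr B (- ((s - t) / 4))"
  have sa: "self_adjoint (op_powr A r)" "self_adjoint (op_powr B r)" for r
    by (simp_all add: op_powr_self_adjoint A B)
  have "rsymmetric T"
    unfolding T_def by (intro rsymmetric_sandwich self_adjointD(2) sa)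
  have Z: "is_inverse Z Z'"
    unfolding Z_def Z'_def by (rule is_inverse_op_powr[OF B])
  let ?L = "op_powr B (- s / 2) o\<^sub>L op_powr A (s / 2)" and ?R = "op_powr A (t / 2) o\<^sub>L op_powr B (- t / 2)"
  have "is_adjoint (op_powr A (s / 2) o\<^sub>L op_powr B (- s / 2)) ?L"
    by (intro is_adjoint_compose is_adjoint_self self_adjointD(2) sa)
  from norm_adjoint_le[OF this] have L: "norm ?L \<le> 1"
    using loewner_le_imp_contraction[OF A B s] by linarith
  have "Z' o\<^sub>L T o\<^sub>L Z = ?L o\<^sub>L ?R"
  proof (rule blinfun_eqI)
    fix x
    have exps: "- ((s - t) / 4) + - u / 2 = - s / 2" "- u / 2 + (s - t) / 4 = - t / 2" "s / 2 + t / 2 = u"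
      by (simp_all add: u_def field_simps)
    show "(Z' o\<^sub>L T o\<^sub>L Z) x = (?L o\<^sub>L ?R) x"
      by (simp only: Z_def Z'_def T_def blinfun_apply_blinfun_compose op_powr_apply[OF A] op_powr_apply[OF B] exps)
  qed
  also have "norm (?L o\<^sub>L ?R) \<le> norm ?L * norm ?R" by (rule norm_blinfun_compose)
  also have "\<dots> \<le> 1 * 1"
    by (intro mult_mono L loewner_le_imp_contraction[OF A B t]) auto
  finally have T: "norm T \<le> 1"
    using norm_le_similar[OF \<open>rsymmetric T\<close> Z, of 1] by simp
  have "rip x (op_powr A u x) \<le> rip x (op_powr B u x)" for x
  proof -
    let ?y = "op_powr B (u / 2) x"
    have y: "op_powr B (- u / 2) ?y = x" by (simp add: op_powr_apply[OF B] op_powr_0[OF B])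
    have "rip x (op_powr A u x) = rip (op_powr B (- u / 2) ?y) (op_powr A u (op_powr B (- u / 2) ?y))"
      unfolding y ..
    also have "\<dots> = rip ?y (T ?y)"
      unfolding self_adjointD(3)[OF sa(2)] T_def by simp
    also have "\<dots> \<le> norm ?y * norm (T ?y)" by (rule rip_le)
    also have "\<dots> \<le> norm ?y * (1 * norm ?y)"
      using norm_blinfun[of T ?y] mult_right_mono[OF T, of "norm ?y"] by (intro mult_left_mono) auto
    also have "\<dots> = rip x (op_powr B u x)"
      using norm_op_powr_apply[OF B, of u x] by (simp add: power2_eq_square)
    finally show ?thesis .
  qed
  then show ?thesis by (simp add: loewner_le_iff sa u_def)
qed

text \<open>\<open>x powr s\<close> is uniformly continuous on a compact rectangle in \<open>(x, s)\<close>, so nearby exponents give uniformly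
  close functions of \<open>x\<close>.\<close>

lemma continuous_on_op_powr_exponent:
  assumes "A \<in> pos_invertible_ops"
  shows "continuous_on {a..b} (op_powr A)"
proof -
  obtain m M where m: "0 < m" and A: "spectrum_within A m M" using pos_invertible_spectrum[OF assms] by blast
  have "continuous_on ({m..M} \<times> {a..b}) (\<lambda>z. fst z powr snd z)"
    using m by (intro continuous_intros) auto
  then have uc: "uniformly_continuous_on ({m..M} \<times> {a..b}) (\<lambda>z. fst z powr snd z)"
    by (rule compact_uniformly_continuous) (intro compact_Times compact_Icc)
  show ?thesis
    unfolding continuous_on_iff
  proof (intro ballI allI impI)
    fix s e :: real assume s: "s \<in> {a..b}" and e: "e > 0"
    obtain d where d: "d > 0" "\<And>z z'. z \<in> {m..M} \<times> {a..b} \<Longrightarrow> z' \<in> {m..M} \<times> {a..b} \<Longrightarrow> dist z' z < d \<Longrightarrow>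
        dist (fst z' powr snd z') (fst z powr snd z) < e / 2"
      using uc e unfolding uniformly_continuous_on_def by (metis half_gt_zero)
    have "dist (op_powr A t) (op_powr A s) < e" if t: "t \<in> {a..b}" "dist t s < d" for t
    proof -
      have c: "continuous_on {m..M} (\<lambda>x. x powr t)" "continuous_on {m..M} (\<lambda>x. x powr s)"
        by (intro continuous_on_powr_Icc m)+
      have "norm (op_fun_calc (\<lambda>x. x powr t - x powr s) A) \<le> e / 2"
      proof (rule norm_op_fun_calc_le[OF A continuous_on_diff[OF c]])
        show "\<bar>x powr t - x powr s\<bar> \<le> e / 2" if "x \<in> {m..M}" for x
          using d(2)[of "(x, s)" "(x, t)"] that s t by (simp add: dist_Pair_Pair dist_real_def)
      qed (use e in simp)
      then show ?thesis
        using e by (simp add: dist_norm op_powr_def op_fun_calc_diff[OF A c])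
    qed
    with d(1) show "\<exists>d>0. \<forall>t\<in>{a..b}. dist t s < d \<longrightarrow> dist (op_powr A t) (op_powr A s) < e"
      by blast
  qed
qed

text \<open>A point outside \<open>S\<close> would lie in a gap between consecutive points of the closed set \<open>S\<close>, whose midpoint is in \<open>S\<close>.\<close>

lemma closed_midpoint_closed_interval:
  fixes S :: "real set"
  assumes "closed S" and mid: "\<And>s t. s \<in> S \<Longrightarrow> t \<in> S \<Longrightarrow> (s + t) / 2 \<in> S"
    and ab: "a \<in> S" "b \<in> S" "a \<le> s" "s \<le> b"
  shows "s \<in> S"
proof (rule ccontr)
  assume s: "s \<notin> S"
  let ?P = "S \<inter> {a..s}" and ?Q = "S \<inter> {s..b}"
  have P: "Sup ?P \<in> ?P"
    by (rule closed_contains_Sup) (use ab in \<open>auto intro: closed_Int \<open>closed S\<close>\<close>)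
  have Q: "Inf ?Q \<in> ?Q"
    by (rule closed_contains_Inf) (use ab in \<open>auto intro: closed_Int \<open>closed S\<close>\<close>)
  have "Sup ?P \<noteq> s" "Inf ?Q \<noteq> s" using P Q s by auto
  with P Q have lt: "Sup ?P < s" "s < Inf ?Q" by auto
  let ?c = "(Sup ?P + Inf ?Q) / 2"
  have c: "?c \<in> S" using P Q by (intro mid) auto
  show False
  proof (cases "?c \<le> s")
    case True
    then have "?c \<in> ?P" using c P lt by auto
    then have "?c \<le> Sup ?P" by (rule cSup_upper) simp
    with lt show False by simp
  next
    case False
    then have "?c \<in> ?Q" using c Q lt by auto
    then have "Inf ?Q \<le> ?c" by (rule cInf_lower) simp
    with lt show False by simp
  qed
qed

text \<open>The exponents for which the inequality holds form a closed set that contains \<open>0\<close> and \<open>1\<close> and is stable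
  under midpoints.\<close>

theorem Loewner_Heinz:
  assumes A: "A \<in> pos_invertible_ops" and B: "B \<in> pos_invertible_ops" and le: "A \<le>\<^sub>L B"
    and s: "0 \<le> s" "s \<le> 1"
  shows "op_powr A s \<le>\<^sub>L op_powr B s"
proof -
  define S where "S = {r \<in> {0..1}. op_powr A r \<le>\<^sub>L op_powr B r}"
  have sa: "self_adjoint (op_powr A r)" "self_adjoint (op_powr B r)" for r
    by (simp_all add: op_powr_self_adjoint A B)
  have "closed S"
    unfolding closed_sequential_limits
  proof (intro allI impI, elim conjE)
    fix r l assume r: "\<forall>n. r n \<in> S" and l: "r \<longlonglongrightarrow> l"
    have l01: "l \<in> {0..1}"
      using closed_sequentially[OF closed_atLeastAtMost _ l, of 0 1] r by (auto simp: S_def)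
    have lim: "(\<lambda>n. rip x (op_powr D (r n) x)) \<longlonglongrightarrow> rip x (op_powr D l x)"
      if "D \<in> pos_invertible_ops" for D and x :: 'a
    proof -
      have "(\<lambda>n. op_powr D (r n)) \<longlonglongrightarrow> op_powr D l"
        using r by (intro continuous_on_tendsto_compose[OF continuous_on_op_powr_exponent[OF that] l l01])
          (auto simp: S_def)
      then have "(\<lambda>n. op_powr D (r n) x) \<longlonglongrightarrow> op_powr D l x"
        by (intro blinfun.tendsto tendsto_const)
      then show ?thesis by (rule bounded_linear.tendsto[OF bounded_linear_rip])
    qed
    have "rip x (op_powr A l x) \<le> rip x (op_powr B l x)" for x
      by (rule LIMSEQ_le[OF lim[OF A] lim[OF B]]) (use r in \<open>auto simp: S_def loewner_le_iff sa\<close>)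
    with l01 show "l \<in> S" by (simp add: S_def loewner_le_iff sa)
  qed
  moreover have "0 \<in> S" by (simp add: S_def op_powr_0 A B loewner_le_iff self_adjoint_id)
  moreover have "1 \<in> S" by (simp add: S_def op_powr_1 A B le)
  ultimately have "s \<in> S"
    using s by (rule_tac closed_midpoint_closed_interval[of S 0 1])
      (auto simp: S_def intro: Loewner_Heinz_midpoint[OF A B])
  then show ?thesis by (simp add: S_def)
qed

section \<open>The weighted geometric mean of two operators\<close>

text \<open>The weighted geometric mean \<open>A #\<^sub>s X\<close> of Kubo and Ando; the recursion for the mean of several operators is an
  instance of it.\<close>

definition wmean :: "real \<Rightarrow> ('a::complex_hilbert \<Rightarrow>\<^sub>L 'a) \<Rightarrow> ('a \<Rightarrow>\<^sub>L 'a) \<Rightarrow> ('a \<Rightarrow>\<^sub>L 'a)" where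
  "wmean s A X = op_powr A (1/2) o\<^sub>L op_powr (op_powr A (- 1/2) o\<^sub>L X o\<^sub>L op_powr A (- 1/2)) s
     o\<^sub>L op_powr A (1/2)"

lemma wmean_pos_invertible:
  "A \<in> pos_invertible_ops \<Longrightarrow> X \<in> pos_invertible_ops \<Longrightarrow> wmean s A X \<in> pos_invertible_ops"
  unfolding wmean_def by (intro sandwich_pos_invertible op_powr_pos_invertible)

text \<open>With \<open>A' = C\<^sup>* A C\<close> and \<open>X' = C\<^sup>* X C\<close>, the unitary \<open>W = A\<^bsup>1/2\<^esup> C A'\<^bsup>-1/2\<^esup>\<close> of a polar
  decomposition intertwines \<open>A'\<^bsup>-1/2\<^esup> X' A'\<^bsup>-1/2\<^esup>\<close> with \<open>A\<^bsup>-1/2\<^esup> X A\<^bsup>-1/2\<^esup>\<close>, hence also their powers.\<close>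

lemma wmean_congruence:
  assumes A: "A \<in> pos_invertible_ops" and X: "X \<in> pos_invertible_ops"
    and C: "clinear_op C" "is_inverse C D" "is_adjoint C C'"
  shows "wmean s (C' o\<^sub>L A o\<^sub>L C) (C' o\<^sub>L X o\<^sub>L C) = C' o\<^sub>L wmean s A X o\<^sub>L C"
proof -
  define A' where "A' = C' o\<^sub>L A o\<^sub>L C"
  define X' where "X' = C' o\<^sub>L X o\<^sub>L C"
  have A': "A' \<in> pos_invertible_ops" and X': "X' \<in> pos_invertible_ops"
    unfolding A'_def X'_def by (intro congruence_pos_invertible[OF _ C] A X)+
  define Y where "Y = op_powr A (- 1/2) o\<^sub>L X o\<^sub>L op_powr A (- 1/2)"
  define Y' where "Y' = op_powr A' (- 1/2) o\<^sub>L X' o\<^sub>L op_powr A' (- 1/2)"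
  define W where "W = op_powr A (1/2) o\<^sub>L C o\<^sub>L op_powr A' (- 1/2)"
  obtain D' where D': "is_adjoint D D'" by (rule adjoint_exists)
  have inv: "is_inverse C' D'" by (rule is_adjoint_inverse[OF C(3,2) D'])
  have half: "op_powr B (- (1/2)) (op_powr B (- (1/2)) x) = op_powr B (- 1) x"
    "op_powr B (1/2) (op_powr B (- 1) x) = op_powr B (- (1/2)) x"
    "op_powr B (1/2) (op_powr B (- (1/2)) x) = x"
    "op_powr B (- (1/2)) (op_powr B (1/2) x) = x"
    "op_powr B (1/2) (op_powr B (1/2) x) = B x"
    "B (op_powr B (- (1/2)) x) = op_powr B (1/2) x"
    if B: "B \<in> pos_invertible_ops" for B and x :: 'a
    using op_powr_apply[OF B, of 1 "- (1/2)" x]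
    by (simp_all add: op_powr_apply[OF B] op_powr_0[OF B] op_powr_1[OF B])
  have "is_inverse A' (D o\<^sub>L (op_powr A (- 1) o\<^sub>L D'))"
    unfolding A'_def using is_inverse_op_powr[OF A, of 1]
    by (intro is_inverse_compose inv C) (simp add: op_powr_1[OF A])
  moreover have "is_inverse A' (op_powr A' (- 1))"
    using is_inverse_op_powr[OF A', of 1] by (simp add: op_powr_1[OF A'])
  ultimately have "op_powr A' (- 1) = D o\<^sub>L (op_powr A (- 1) o\<^sub>L D')"
    using is_inverse_unique by blast
  then have A'_inv: "C (op_powr A' (- 1) (C' x)) = op_powr A (- 1) x" for x
    by (simp add: is_inverse_apply[OF C(2)] is_inverse_apply[OF inv])
  have "W o\<^sub>L Y' = Y o\<^sub>L W"
    by (rule blinfun_eqI) (simp add: W_def Y_def Y'_def X'_def half[OF A] half[OF A'] A'_inv)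
  then have W: "W o\<^sub>L op_powr Y' s = op_powr Y s o\<^sub>L W"
    unfolding Y_def Y'_def
    by (intro op_powr_intertwine sandwich_pos_invertible op_powr_pos_invertible A X A' X')
  have W_apply: "W (op_powr Y' s x) = op_powr Y s (W x)" for x
    using arg_cong[OF W, of "\<lambda>T. blinfun_apply T x"] by simp
  have left: "op_powr A' (1/2) x = C' (op_powr A (1/2) (W x))" for x
    using half(6)[OF A', of x] by (simp add: W_def half[OF A]) (simp add: A'_def)
  have right: "W (op_powr A' (1/2) x) = op_powr A (1/2) (C x)" for x
    by (simp add: W_def half[OF A'])
  have "wmean s A' X' = C' o\<^sub>L wmean s A X o\<^sub>L C"
  proof (rule blinfun_eqI)
    fix x
    have "wmean s A' X' x = op_powr A' (1/2) (op_powr Y' s (op_powr A' (1/2) x))"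
      by (simp add: wmean_def Y'_def)
    also have "\<dots> = C' (op_powr A (1/2) (op_powr Y s (op_powr A (1/2) (C x))))"
      unfolding left[of "op_powr Y' s _"] W_apply right ..
    finally show "wmean s A' X' x = (C' o\<^sub>L wmean s A X o\<^sub>L C) x"
      by (simp add: wmean_def Y_def)
  qed
  then show ?thesis by (simp add: A'_def X'_def)
qed

lemma id_pos_invertible: "id_blinfun \<in> pos_invertible_ops"
  by (auto simp: pos_invertible_iff self_adjoint_id rip_self is_inverse_def)

text \<open>The definition treats the two arguments very differently, and monotonicity in the first one is not
  visible from it; exchanging them turns it into monotonicity in the second one.
  The congruence by \<open>A\<^bsup>1/2\<^esup>\<close> reduces the claim to the pair \<open>(id, Y)\<close> with
  \<open>Y = A\<^bsup>-1/2\<^esup> X A\<^bsup>-1/2\<^esup>\<close>, where both sides are \<open>Y\<^sup>s\<close>.\<close>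

lemma wmean_swap:
  assumes A: "A \<in> pos_invertible_ops" and X: "X \<in> pos_invertible_ops"
  shows "wmean s A X = wmean (1 - s) X A"
proof -
  let ?S = "op_powr A (1/2)"
  define Y where "Y = op_powr A (- 1/2) o\<^sub>L X o\<^sub>L op_powr A (- 1/2)"
  have Y: "Y \<in> pos_invertible_ops"
    unfolding Y_def by (intro sandwich_pos_invertible op_powr_pos_invertible A X)
  have S: "clinear_op ?S" "is_inverse ?S (op_powr A (- (1/2)))" "is_adjoint ?S ?S"
    using op_powr_self_adjoint[OF A] is_inverse_op_powr[OF A]
    by (auto simp: self_adjointD intro: is_adjoint_self)
  have X_eq: "?S o\<^sub>L Y o\<^sub>L ?S = X"
    by (rule blinfun_eqI) (simp add: Y_def op_powr_apply[OF A] op_powr_0[OF A])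
  have A_eq: "?S o\<^sub>L ?S = A"
    by (simp add: op_powr_1[OF A] flip: op_powr_add[OF A])
  have Y_inv: "op_powr Y (- 1/2) o\<^sub>L id_blinfun o\<^sub>L op_powr Y (- 1/2) = op_powr Y (- 1)"
    by (simp flip: op_powr_add[OF Y])
  have "wmean (1 - s) Y id_blinfun = op_powr Y (1/2 + - (1 - s) + 1/2)"
    unfolding wmean_def Y_inv op_powr_powr[OF Y] op_powr_add[OF Y] by simp
  also have "1/2 + - (1 - s) + 1/2 = s" by simp
  finally have "wmean (1 - s) X A = ?S o\<^sub>L op_powr Y s o\<^sub>L ?S"
    using wmean_congruence[OF Y id_pos_invertible S, of "1 - s"] by (simp add: X_eq A_eq)
  then show ?thesis by (simp add: wmean_def Y_def)
qed

lemma wmean_mono_right: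
  assumes P: "A \<in> pos_invertible_ops" "X \<in> pos_invertible_ops" "X' \<in> pos_invertible_ops"
    and "X \<le>\<^sub>L X'" and s: "0 \<le> s" "s \<le> 1"
  shows "wmean s A X \<le>\<^sub>L wmean s A X'"
  unfolding wmean_def
  by (intro sandwich_mono Loewner_Heinz op_powr_self_adjoint sandwich_pos_invertible
      op_powr_pos_invertible assms pos_invertible_self_adjoint)

lemma wmean_mono_left:
  assumes P: "A \<in> pos_invertible_ops" "A' \<in> pos_invertible_ops" "X \<in> pos_invertible_ops"
    and "A \<le>\<^sub>L A'" and s: "0 \<le> s" "s \<le> 1"
  shows "wmean s A X \<le>\<^sub>L wmean s A' X"
  unfolding wmean_swap[OF P(1,3)] wmean_swap[OF P(2,3)]
  by (rule wmean_mono_right) (use assms in auto)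

text \<open>The scalars collect to \<open>t * (u / t) powr s\<close>.\<close>

lemma wmean_scaleR:
  assumes A: "A \<in> pos_invertible_ops" and X: "X \<in> pos_invertible_ops" and t: "0 < t" "0 < u"
  shows "wmean s (t *\<^sub>R A) (u *\<^sub>R X) = (t powr (1 - s) * u powr s) *\<^sub>R wmean s A X"
proof -
  define Y where "Y = op_powr A (- 1/2) o\<^sub>L X o\<^sub>L op_powr A (- 1/2)"
  have Y: "Y \<in> pos_invertible_ops"
    unfolding Y_def by (intro sandwich_pos_invertible op_powr_pos_invertible A X)
  have inner: "op_powr (t *\<^sub>R A) (- 1/2) o\<^sub>L u *\<^sub>R X o\<^sub>L op_powr (t *\<^sub>R A) (- 1/2) = (u / t) *\<^sub>R Y"
  proof -
    have "t powr (- 1/2) * (t powr (- 1/2) * u) = u / t"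
      using t by (simp add: powr_minus_divide flip: mult.assoc powr_add)
    then show ?thesis
      by (simp add: Y_def op_powr_scaleR[OF A t(1)] compose.scaleR_left compose.scaleR_right mult.assoc)
         (simp add: mult.commute mult.left_commute)
  qed
  have "t powr (1/2) * (t powr (1/2) * (u / t) powr s) = t powr (1 - s) * u powr s"
    using t by (simp add: powr_divide powr_diff flip: mult.assoc powr_add)
  then show ?thesis
    using t unfolding wmean_def inner Y_def[symmetric]
    by (simp add: op_powr_scaleR[OF A t(1)] op_powr_scaleR[OF Y] compose.scaleR_left compose.scaleR_right)
       (simp add: mult.commute mult.left_commute)
qed

lemma is_inverse_op_inverse: "A \<in> pos_invertible_ops \<Longrightarrow> is_inverse A (op_inverse A)"
  using is_inverse_op_powr[of A 1] by (simp add: op_inverse_eq_powr op_powr_1)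

lemma wmean_inverse:
  assumes A: "A \<in> pos_invertible_ops" and X: "X \<in> pos_invertible_ops"
  shows "wmean s (op_inverse A) (op_inverse X) = op_inverse (wmean s A X)"
proof -
  define Y where "Y = op_powr A (- 1/2) o\<^sub>L X o\<^sub>L op_powr A (- 1/2)"
  have Y: "Y \<in> pos_invertible_ops"
    unfolding Y_def by (intro sandwich_pos_invertible op_powr_pos_invertible A X)
  have half: "is_inverse (op_powr A (- 1/2)) (op_powr A (1/2))" "is_inverse (op_powr A (1/2)) (op_powr A (- 1/2))"
    using is_inverse_op_powr[OF A, of "1/2"] is_inverse_sym by auto
  have "is_inverse Y (op_powr A (1/2) o\<^sub>L (op_inverse X o\<^sub>L op_powr A (1/2)))"
    unfolding Y_def by (intro is_inverse_compose half is_inverse_op_inverse X)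
  then have "op_powr A (1/2) o\<^sub>L op_inverse X o\<^sub>L op_powr A (1/2) = op_powr Y (- 1)"
    using is_inverse_unique[OF is_inverse_op_inverse[OF Y]] by (simp add: compose_assoc op_inverse_eq_powr[OF Y])
  then have "wmean s (op_inverse A) (op_inverse X)
      = op_powr A (- 1/2) o\<^sub>L op_powr Y (- s) o\<^sub>L op_powr A (- 1/2)"
    by (simp add: wmean_def op_inverse_eq_powr[OF A] op_powr_powr[OF A] op_powr_powr[OF Y])
  moreover have "is_inverse (wmean s A X) (op_powr A (- 1/2) o\<^sub>L (op_powr Y (- s) o\<^sub>L op_powr A (- 1/2)))"
    unfolding wmean_def Y_def[symmetric] by (intro is_inverse_compose half is_inverse_op_powr[OF Y])
  ultimately show ?thesis
    by (simp add: op_inverse_eq compose_assoc)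
qed

section \<open>The geometric mean of several operators\<close>

lemma gmean_rec_cong:
  "k \<ge> 1 \<Longrightarrow> (\<And>i. i \<in> {1..k} \<Longrightarrow> A i = B i) \<Longrightarrow> gmean_rec mul pw k A = gmean_rec mul pw k B"
proof (induction k arbitrary: A B)
  case (Suc k)
  have last: "A (Suc k) = B (Suc k)" using Suc.prems by simp
  show ?case
  proof (cases "k = 0")
    case False
    have "gmean_rec mul pw k (\<lambda>i. mul (mul T (A i)) T) = gmean_rec mul pw k (\<lambda>i. mul (mul T (B i)) T)" for T
      using False Suc.prems by (intro Suc.IH) auto
    then show ?thesis using False by (simp add: last)
  qed (use last in simp)
qed simp

lemma op_gmean_cong: "k \<ge> 1 \<Longrightarrow> (\<And>i. i \<in> {1..k} \<Longrightarrow> A i = B i) \<Longrightarrow> op_gmean k A = op_gmean k B"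
  unfolding op_gmean_def by (rule gmean_rec_cong)

lemma op_gmean_1: "op_gmean (Suc 0) A = A 1"
  by (simp add: op_gmean_def)

text \<open>Congruence invariance at \<open>k\<close> turns the recursion into
  \<open>G\<^bsub>k+1\<^esub>(A\<^sub>1, \<dots>, A\<^bsub>k+1\<^esub>) = wmean (k/(k+1)) A\<^bsub>k+1\<^esub> (G\<^sub>k(A\<^sub>1, \<dots>, A\<^sub>k))\<close>, which in turn gives
  congruence invariance at \<open>k + 1\<close>; hence the joint induction.\<close>

lemma op_gmean_congruence_recursion:
  assumes "k \<ge> 1"
  shows "(\<forall>i\<in>{1..k}. A i \<in> pos_invertible_ops) \<Longrightarrow> op_gmean k A \<in> pos_invertible_ops"
    and "(\<forall>i\<in>{1..k}. A i \<in> pos_invertible_ops) \<Longrightarrow> clinear_op C \<Longrightarrow> is_inverse C D \<Longrightarrow> is_adjoint C C' \<Longrightarrow>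
      op_gmean k (\<lambda>i. C' o\<^sub>L A i o\<^sub>L C) = C' o\<^sub>L op_gmean k A o\<^sub>L C"
    and "(\<forall>i\<in>{1..Suc k}. A i \<in> pos_invertible_ops) \<Longrightarrow>
      op_gmean (Suc k) A = wmean (real k / real (k + 1)) (A (Suc k)) (op_gmean k A)"
proof -
  have rec: "op_gmean (Suc k) A = wmean (real k / real (k + 1)) (A (Suc k)) (op_gmean k A)"
    if k: "k \<ge> 1" and A: "\<forall>i\<in>{1..Suc k}. A i \<in> pos_invertible_ops"
      and cong: "\<And>C D C'. clinear_op C \<Longrightarrow> is_inverse C D \<Longrightarrow> is_adjoint C C' \<Longrightarrow>
        op_gmean k (\<lambda>i. C' o\<^sub>L A i o\<^sub>L C) = C' o\<^sub>L op_gmean k A o\<^sub>L C" for k and A :: "nat \<Rightarrow> 'a \<Rightarrow>\<^sub>L 'a"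
  proof -
    let ?T = "op_powr (A (Suc k)) (- 1/2)"
    have last: "A (Suc k) \<in> pos_invertible_ops" using A by simp
    have "op_gmean k (\<lambda>i. ?T o\<^sub>L A i o\<^sub>L ?T) = ?T o\<^sub>L op_gmean k A o\<^sub>L ?T"
      by (rule cong[OF _ is_inverse_op_powr[OF last]])
        (use op_powr_self_adjoint[OF last] in \<open>auto simp: self_adjointD intro: is_adjoint_self\<close>)
    then show ?thesis
      using k by (simp add: op_gmean_def wmean_def Let_def)
  qed
  have main: "op_gmean k A \<in> pos_invertible_ops \<and> (\<forall>C D C'. clinear_op C \<longrightarrow> is_inverse C D \<longrightarrow> is_adjoint C C' \<longrightarrow>
      op_gmean k (\<lambda>i. C' o\<^sub>L A i o\<^sub>L C) = C' o\<^sub>L op_gmean k A o\<^sub>L C)"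
    if "k \<ge> 1" "\<forall>i\<in>{1..k}. A i \<in> pos_invertible_ops" for k and A :: "nat \<Rightarrow> 'a \<Rightarrow>\<^sub>L 'a"
    using that
  proof (induction k arbitrary: A)
    case (Suc k)
    show ?case
    proof (cases "k = 0")
      case True
      with Suc.prems show ?thesis by (simp add: op_gmean_1)
    next
      case False
      then have k: "k \<ge> 1" by simp
      have P: "\<forall>i\<in>{1..k}. A i \<in> pos_invertible_ops" and last: "A (Suc k) \<in> pos_invertible_ops"
        using Suc.prems by auto
      note IH = Suc.IH[OF k]
      have eq: "op_gmean (Suc k) B = wmean (real k / real (k + 1)) (B (Suc k)) (op_gmean k B)"
        if B: "\<forall>i\<in>{1..Suc k}. B i \<in> pos_invertible_ops" for B :: "nat \<Rightarrow> 'a \<Rightarrow>\<^sub>L 'a"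
        using IH[of B] B by (intro rec[OF k B]) auto
      have "op_gmean (Suc k) (\<lambda>i. C' o\<^sub>L A i o\<^sub>L C) = C' o\<^sub>L op_gmean (Suc k) A o\<^sub>L C"
        if C: "clinear_op C" "is_inverse C D" "is_adjoint C C'" for C D C'
      proof -
        have IHC: "op_gmean k (\<lambda>i. C' o\<^sub>L A i o\<^sub>L C) = C' o\<^sub>L op_gmean k A o\<^sub>L C"
          using IH[OF P] C by blast
        have "op_gmean (Suc k) (\<lambda>i. C' o\<^sub>L A i o\<^sub>L C) =
          wmean (real k / real (k + 1)) (C' o\<^sub>L A (Suc k) o\<^sub>L C) (C' o\<^sub>L op_gmean k A o\<^sub>L C)"
          using Suc.prems by (subst eq) (auto simp only: IHC intro!: congruence_pos_invertible C)
        then show ?thesis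
          using wmean_congruence[OF last _ C] IH[OF P] eq[OF Suc.prems(2)] by simp
      qed
      then show ?thesis
        using wmean_pos_invertible[OF last] IH[OF P] eq[OF Suc.prems(2)] by auto
    qed
  qed simp
  show "op_gmean k A \<in> pos_invertible_ops" if "\<forall>i\<in>{1..k}. A i \<in> pos_invertible_ops"
    using main[OF assms that] by blast
  show "op_gmean k (\<lambda>i. C' o\<^sub>L A i o\<^sub>L C) = C' o\<^sub>L op_gmean k A o\<^sub>L C"
    if "\<forall>i\<in>{1..k}. A i \<in> pos_invertible_ops" "clinear_op C" "is_inverse C D" "is_adjoint C C'"
    using main[OF assms that(1)] that by blast
  show "op_gmean (Suc k) A = wmean (real k / real (k + 1)) (A (Suc k)) (op_gmean k A)"
    if "\<forall>i\<in>{1..Suc k}. A i \<in> pos_invertible_ops"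
    using main[OF assms, of A] that by (intro rec[OF assms that]) auto
qed

lemmas op_gmean_pos_invertible = op_gmean_congruence_recursion(1)
  and op_gmean_congruence = op_gmean_congruence_recursion(2)
  and op_gmean_Suc = op_gmean_congruence_recursion(3)

lemma op_gmean_mono:
  assumes "k \<ge> 1" and "\<forall>i\<in>{1..k}. A i \<in> pos_invertible_ops" and "j \<in> {1..k}"
    and B: "B \<in> pos_invertible_ops" and le: "A j \<le>\<^sub>L B"
  shows "op_gmean k A \<le>\<^sub>L op_gmean k (A(j := B))"
  using assms(1-3)
proof (induction k rule: nat_induct_at_least)
  case base
  with le show ?case by (auto simp: op_gmean_1)
next
  case (Suc k)
  let ?s = "real k / real (k + 1)" and ?A = "A(j := B)"
  have s: "0 \<le> ?s" "?s \<le> 1" by auto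
  have P: "\<forall>i\<in>{1..k}. A i \<in> pos_invertible_ops" "A (Suc k) \<in> pos_invertible_ops"
    and P': "\<forall>i\<in>{1..Suc k}. ?A i \<in> pos_invertible_ops" using Suc.prems B by auto
  then have P'': "\<forall>i\<in>{1..k}. ?A i \<in> pos_invertible_ops" by auto
  have G: "op_gmean k A \<in> pos_invertible_ops" "op_gmean k ?A \<in> pos_invertible_ops"
    by (intro op_gmean_pos_invertible Suc.hyps P(1) P'')+
  have "wmean ?s (A (Suc k)) (op_gmean k A) \<le>\<^sub>L wmean ?s (?A (Suc k)) (op_gmean k ?A)"
  proof (cases "j = Suc k")
    case True
    then have "op_gmean k ?A = op_gmean k A" by (intro op_gmean_cong Suc.hyps) auto
    then show ?thesis
      using True le wmean_mono_left[OF P(2) B G(1) _ s] by simp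
  next
    case False
    then have "op_gmean k A \<le>\<^sub>L op_gmean k ?A" using Suc.prems(2) by (intro Suc.IH P(1)) auto
    then show ?thesis using False wmean_mono_right[OF P(2) G _ s] by simp
  qed
  then show ?case
    by (simp only: op_gmean_Suc[OF Suc.hyps Suc.prems(1)] op_gmean_Suc[OF Suc.hyps P'])
qed

text \<open>In the step, the exponents are \<open>1 - k / (k + 1) = 1 / (k + 1)\<close> for the last scalar and
  \<open>(1 / k) * (k / (k + 1)) = 1 / (k + 1)\<close> for the others.\<close>

lemma op_gmean_scaleR:
  assumes "k \<ge> 1" and "\<forall>i\<in>{1..k}. A i \<in> pos_invertible_ops" and "\<forall>i\<in>{1..k}. t i > 0"
  shows "op_gmean k (\<lambda>i. t i *\<^sub>R A i) = ((\<Prod>i=1..k. t i) powr (1 / real k)) *\<^sub>R op_gmean k A"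
  using assms
proof (induction k rule: nat_induct_at_least)
  case base
  then show ?case by (simp add: op_gmean_1)
next
  case (Suc k)
  let ?s = "real k / real (k + 1)" and ?p = "\<Prod>i=1..k. t i"
  have P: "\<forall>i\<in>{1..k}. A i \<in> pos_invertible_ops" "A (Suc k) \<in> pos_invertible_ops" "t (Suc k) > 0"
    and P': "\<forall>i\<in>{1..Suc k}. t i *\<^sub>R A i \<in> pos_invertible_ops"
    using Suc.prems scaleR_pos_invertible by auto
  have p: "?p > 0" using Suc.prems by (intro prod_pos) auto
  have "op_gmean (Suc k) (\<lambda>i. t i *\<^sub>R A i)
      = wmean ?s (t (Suc k) *\<^sub>R A (Suc k)) (?p powr (1 / real k) *\<^sub>R op_gmean k A)"
    using Suc by (subst op_gmean_Suc[OF Suc.hyps P']) simp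
  also have "\<dots> = (t (Suc k) powr (1 - ?s) * (?p powr (1 / real k)) powr ?s) *\<^sub>R op_gmean (Suc k) A"
    using p by (subst wmean_scaleR)
      (auto simp only: op_gmean_Suc[OF Suc.hyps Suc.prems(1)] P op_gmean_pos_invertible[OF Suc.hyps P(1)] powr_gt_zero)
  also have "t (Suc k) powr (1 - ?s) * (?p powr (1 / real k)) powr ?s = (\<Prod>i=1..Suc k. t i) powr (1 / real (Suc k))"
  proof -
    have "1 - ?s = 1 / real (Suc k)" "1 / real k * ?s = 1 / real (Suc k)"
      using Suc.hyps by (auto simp: field_simps)
    then show ?thesis
      using p P(3) by (simp add: powr_powr powr_mult mult.commute)
  qed
  finally show ?case .
qed

lemma op_gmean_inverse:
  assumes "k \<ge> 1" and "\<forall>i\<in>{1..k}. A i \<in> pos_invertible_ops"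
  shows "op_gmean k (\<lambda>i. op_inverse (A i)) = op_inverse (op_gmean k A)"
  using assms
proof (induction k rule: nat_induct_at_least)
  case base
  show ?case by (simp add: op_gmean_1)
next
  case (Suc k)
  have P: "\<forall>i\<in>{1..k}. A i \<in> pos_invertible_ops" "A (Suc k) \<in> pos_invertible_ops"
    and P': "\<forall>i\<in>{1..Suc k}. op_inverse (A i) \<in> pos_invertible_ops"
    using Suc.prems by (auto simp: op_inverse_eq_powr op_powr_pos_invertible)
  show ?case
    using wmean_inverse[OF P(2) op_gmean_pos_invertible[OF Suc.hyps P(1)]] Suc.IH[OF P(1)]
    by (simp only: op_gmean_Suc[OF Suc.hyps P'] op_gmean_Suc[OF Suc.hyps Suc.prems])
qed

section \<open>Matrices and determinants\<close>

definition op_of_matrix :: "complex ^ 'n ^ 'n \<Rightarrow> (complex ^ 'n) \<Rightarrow>\<^sub>L (complex ^ 'n)" where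
  "op_of_matrix A = Blinfun (\<lambda>x. A *v x)"

definition matrix_of_op :: "(complex ^ 'n) \<Rightarrow>\<^sub>L (complex ^ 'n) \<Rightarrow> complex ^ 'n ^ 'n" where
  "matrix_of_op T = matrix (blinfun_apply T)"

lemma op_of_matrix_apply: "op_of_matrix A x = A *v x"
  by (simp add: op_of_matrix_def bounded_linear_Blinfun_apply)

lemma scaleC_eq_scalar_mult: "c *\<^sub>C x = c *s (x :: complex ^ 'n)"
  by (simp add: scaleC_vec_def scaleC_complex_def vector_scalar_mult_def)

lemma clinear_op_of_matrix: "clinear_op (op_of_matrix A)"
  by (simp add: clinear_op_def op_of_matrix_apply scaleC_eq_scalar_mult vector_scalar_commute)

lemma matrix_of_op_apply:
  assumes "clinear_op T"
  shows "matrix_of_op T *v x = T x"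
proof -
  have "Vector_Spaces.linear (*s) (*s) (blinfun_apply T)"
    using assms by unfold_locales
      (simp_all add: blinfun.add_right clinear_op_def scaleC_eq_scalar_mult)
  then show ?thesis by (simp add: matrix_of_op_def matrix_works)
qed

lemma op_of_matrix_of_op: "clinear_op T \<Longrightarrow> op_of_matrix (matrix_of_op T) = T"
  by (rule blinfun_eqI) (simp add: op_of_matrix_apply matrix_of_op_apply)

lemma matrix_of_op_of_matrix: "matrix_of_op (op_of_matrix A) = A"
  by (simp add: matrix_of_op_def op_of_matrix_apply[abs_def])

lemma op_of_matrix_mult: "op_of_matrix (A ** B) = op_of_matrix A o\<^sub>L op_of_matrix B"
  by (rule blinfun_eqI) (simp add: op_of_matrix_apply matrix_vector_mul_assoc)

lemma matrix_of_op_compose: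
  assumes "clinear_op S" "clinear_op T"
  shows "matrix_of_op (S o\<^sub>L T) = matrix_of_op S ** matrix_of_op T"
  using assms
  by (metis matrix_of_op_of_matrix op_of_matrix_mult op_of_matrix_of_op)

lemma matrix_of_op_id: "matrix_of_op id_blinfun = mat 1"
  by (simp add: matrix_eq matrix_of_op_apply[OF clinear_id])

lemma matrix_pos_def_pos_invertible:
  assumes A: "matrix_pos_def A"
  shows "op_of_matrix A \<in> pos_invertible_ops"
proof -
  have pos: "op_positive (op_of_matrix A)"
    unfolding op_positive_def
  proof (intro conjI allI clinear_op_of_matrix)
    fix x
    have "cinner x (A *v x) \<in> \<real> \<and> 0 \<le> Re (cinner x (A *v x))"
    proof (cases "x = 0")
      case True
      then show ?thesis by (simp add: cinner_vec_def cinner_complex_def)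
    next
      case False
      then show ?thesis using A by (auto simp: matrix_pos_def_def intro: less_imp_le)
    qed
    then show "cinner x (op_of_matrix A x) \<in> \<real>\<^sub>\<ge>\<^sub>0"
      by (simp add: op_of_matrix_apply complex_nonneg_Reals_iff complex_is_Real_iff)
  qed
  have "x = 0" if "A *v x = 0" for x
  proof (rule ccontr)
    assume "x \<noteq> 0"
    then have "0 < Re (cinner x (A *v x))" using A by (simp add: matrix_pos_def_def)
    then show False by (simp add: that cinner_vec_def cinner_complex_def)
  qed
  then have "inj ((*v) A)"
    by (intro injI) (metis eq_iff_diff_eq_0 matrix_vector_mult_diff_distrib)
  then obtain B where BA: "B ** A = mat 1" using matrix_left_invertible_injective by blast
  then have AB: "A ** B = mat 1" using matrix_left_right_inverse by blast
  have "is_inverse (op_of_matrix A) (op_of_matrix B)"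
    by (intro is_inverseI) (simp_all add: op_of_matrix_apply matrix_vector_mul_assoc AB BA)
  with pos show ?thesis by (auto simp: pos_invertible_iff op_positive_iff)
qed

definition op_det :: "((complex ^ 'n) \<Rightarrow>\<^sub>L (complex ^ 'n)) \<Rightarrow> complex" where
  "op_det T = det (matrix_of_op T)"

lemma op_det_compose: "clinear_op S \<Longrightarrow> clinear_op T \<Longrightarrow> op_det (S o\<^sub>L T) = op_det S * op_det T"
  by (simp add: op_det_def matrix_of_op_compose det_mul)

lemma op_det_id: "op_det id_blinfun = 1"
  by (simp add: op_det_def matrix_of_op_id)

text \<open>Together with invariance of the determinant under transposition, this makes the determinant of a
  Hermitian matrix real.\<close>

lemma det_map_matrix_cnj: "det (map_matrix cnj A) = cnj (det A)"
  by (simp add: det_def cnj_sum cnj_prod)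

lemma cinner_axis: "cinner (axis i 1) (x :: complex ^ 'n) = x $ i"
proof -
  have "cinner (axis i 1) x = (\<Sum>j\<in>UNIV. if j = i then x $ j else 0)"
    by (simp add: cinner_vec_def cinner_complex_def axis_def if_distrib if_distribR cong: if_cong)
  then show ?thesis by simp
qed

lemma op_det_self_adjoint_real:
  assumes S: "self_adjoint S"
  shows "cnj (op_det S) = op_det S"
proof -
  have entry: "matrix_of_op S $ i $ j = cinner (axis i 1) (S (axis j 1))" for i j
    by (simp add: matrix_of_op_def matrix_def cinner_axis)
  have "map_matrix cnj (matrix_of_op S) = transpose (matrix_of_op S)"
  proof -
    have "cnj (matrix_of_op S $ i $ j) = matrix_of_op S $ j $ i" for i j
    proof -
      have "cnj (matrix_of_op S $ i $ j) = cinner (S (axis j 1)) (axis i 1)"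
        unfolding entry by (metis cinner_commute)
      also have "\<dots> = cinner (axis j 1) (S (axis i 1))"
        using S by (intro is_adjoint_cinner is_adjoint_self) (auto simp: self_adjointD)
      finally show ?thesis by (simp add: entry)
    qed
    then show ?thesis by (simp add: vec_eq_iff transpose_def)
  qed
  then show ?thesis
    using det_map_matrix_cnj[of "matrix_of_op S"] by (simp add: op_det_def)
qed

text \<open>The determinant of a positive invertible operator is real and positive; as a real number it can be raised to
  real powers without the branch of the complex logarithm.\<close>

definition rdet :: "((complex ^ 'n) \<Rightarrow>\<^sub>L (complex ^ 'n)) \<Rightarrow> real" where
  "rdet T = Re (op_det T)"

lemma op_det_eq_rdet: "T \<in> pos_invertible_ops \<Longrightarrow> op_det T = complex_of_real (rdet T)"
  using op_det_self_adjoint_real[of T]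
  by (simp add: pos_invertible_iff rdet_def complex_eq_iff)

lemma rdet_compose:
  assumes "S \<in> pos_invertible_ops" "T \<in> pos_invertible_ops"
  shows "rdet (S o\<^sub>L T) = rdet S * rdet T"
proof -
  have "op_det (S o\<^sub>L T) = complex_of_real (rdet S * rdet T)"
    using assms by (simp add: op_det_compose pos_invertible_self_adjoint self_adjointD op_det_eq_rdet)
  then show ?thesis by (simp add: rdet_def[of "S o\<^sub>L T"])
qed

lemma rdet_sandwich:
  assumes "S \<in> pos_invertible_ops" "T \<in> pos_invertible_ops"
  shows "rdet (S o\<^sub>L T o\<^sub>L S) = rdet S * rdet S * rdet T"
proof -
  have "clinear_op S" "clinear_op T" using assms by (auto simp: pos_invertible_iff self_adjointD)
  then have "op_det (S o\<^sub>L T o\<^sub>L S) = complex_of_real (rdet S * rdet S * rdet T)"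
    using assms by (simp add: op_det_compose clinear_compose op_det_eq_rdet)
  then show ?thesis by (simp add: rdet_def[of "S o\<^sub>L T o\<^sub>L S"])
qed

lemma rdet_op_powr_multiple:
  assumes "T \<in> pos_invertible_ops"
  shows "rdet (op_powr T (real n * r)) = rdet (op_powr T r) ^ n"
proof (induction n)
  case 0
  show ?case by (simp add: op_powr_0[OF assms] rdet_def op_det_id)
next
  case (Suc n)
  then show ?case
    by (simp add: distrib_right op_powr_add[OF assms] rdet_compose op_powr_pos_invertible[OF assms])
qed

text \<open>The determinant is the square of the real determinant of the square root, and it is nonzero.\<close>

lemma rdet_pos:
  assumes T: "T \<in> pos_invertible_ops"
  shows "rdet T > 0"
proof -
  have "rdet T * rdet (op_powr T (- 1)) = rdet (op_powr T (1 + - 1))"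
    unfolding op_powr_add[OF T] op_powr_1[OF T]
    by (simp add: rdet_compose T op_powr_pos_invertible[OF T])
  also have "\<dots> = 1" by (simp add: op_powr_0[OF T] rdet_def op_det_id)
  finally have "rdet T \<noteq> 0" by auto
  moreover have "rdet T = (rdet (op_powr T (1/2)))\<^sup>2"
    using rdet_op_powr_multiple[OF T, of 2 "1/2"] by (simp add: op_powr_1[OF T])
  ultimately show ?thesis by (metis zero_less_power2 power_zero_numeral)
qed

text \<open>For rational exponents, multiplicativity of the determinant and positivity determine
  the value as a root.\<close>

lemma rdet_op_powr_rational:
  assumes T: "T \<in> pos_invertible_ops" and n: "n > 0"
  shows "rdet (op_powr T (real m / real n)) = rdet T powr (real m / real n)"
proof -
  let ?d = "rdet (op_powr T (real m / real n))"
  have pos: "?d > 0" by (intro rdet_pos op_powr_pos_invertible T)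
  have "?d ^ n = rdet T ^ m"
    using rdet_op_powr_multiple[OF T, of n "real m / real n"] rdet_op_powr_multiple[OF T, of m 1] n
    by (simp add: op_powr_1[OF T])
  then have "?d powr real n = rdet T powr real m"
    using pos rdet_pos[OF T] by (simp add: powr_realpow)
  then have "(?d powr real n) powr (1 / real n) = (rdet T powr real m) powr (1 / real n)" by simp
  then show ?thesis using pos n by (simp add: powr_powr)
qed

text \<open>Rational weights suffice for the recursion, whose weights are \<open>k / (k + 1)\<close>.\<close>

lemma rdet_wmean:
  assumes A: "A \<in> pos_invertible_ops" and X: "X \<in> pos_invertible_ops" and n: "n > 0"
  shows "rdet (wmean (real m / real n) A X) = rdet A * (rdet X / rdet A) powr (real m / real n)"
proof -
  let ?T = "op_powr A (- 1/2)" and ?S = "op_powr A (1/2)"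
  have S: "?S \<in> pos_invertible_ops" and T: "?T \<in> pos_invertible_ops"
    by (simp_all add: op_powr_pos_invertible A)
  have "?S o\<^sub>L ?S = A" "?T o\<^sub>L A o\<^sub>L ?T = id_blinfun"
    by (rule blinfun_eqI, use op_powr_apply[OF A, of 1] in \<open>simp add: op_powr_apply[OF A] op_powr_0[OF A] op_powr_1[OF A]\<close>)+
  from this[THEN arg_cong, of rdet] have d: "rdet ?S * rdet ?S = rdet A" "rdet ?T * rdet ?T * rdet A = 1"
    using rdet_compose[OF S S] rdet_sandwich[OF T A] by (simp_all add: rdet_def op_det_id)
  have T_eq: "rdet ?T * rdet ?T = 1 / rdet A"
    using d(2) rdet_pos[OF A] by (simp add: field_simps)
  have Y: "?T o\<^sub>L X o\<^sub>L ?T \<in> pos_invertible_ops" by (intro sandwich_pos_invertible T X)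
  have "rdet (wmean (real m / real n) A X) = rdet A * rdet (?T o\<^sub>L X o\<^sub>L ?T) powr (real m / real n)"
    unfolding wmean_def
    by (subst rdet_sandwich[OF S op_powr_pos_invertible[OF Y]])
      (simp only: d rdet_op_powr_rational[OF Y n])
  also have "rdet (?T o\<^sub>L X o\<^sub>L ?T) = rdet X / rdet A"
    by (simp only: rdet_sandwich[OF T X] T_eq) simp
  finally show ?thesis .
qed

lemma rdet_op_gmean:
  assumes "k \<ge> 1" and "\<forall>i\<in>{1..k}. A i \<in> pos_invertible_ops"
  shows "rdet (op_gmean k A) = (\<Prod>i=1..k. rdet (A i)) powr (1 / real k)"
  using assms
proof (induction k rule: nat_induct_at_least)
  case base
  then have "rdet (A 1) > 0" by (intro rdet_pos) simp
  then show ?case by (simp add: op_gmean_1)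
next
  case (Suc k)
  let ?s = "real k / real (k + 1)" and ?p = "\<Prod>i=1..k. rdet (A i)" and ?a = "rdet (A (Suc k))"
  have P: "\<forall>i\<in>{1..k}. A i \<in> pos_invertible_ops" "A (Suc k) \<in> pos_invertible_ops" using Suc.prems by auto
  have p: "?p > 0" using P by (intro prod_pos) (auto intro: rdet_pos)
  have a: "?a > 0" by (rule rdet_pos[OF P(2)])
  have "rdet (op_gmean (Suc k) A) = ?a * (rdet (op_gmean k A) / ?a) powr ?s"
    unfolding op_gmean_Suc[OF Suc.hyps Suc.prems]
    by (rule rdet_wmean[OF P(2) op_gmean_pos_invertible[OF Suc.hyps P(1)]]) simp
  also have "\<dots> = ?a * (?p powr (1 / real k) / ?a) powr ?s"
    using Suc.IH P by simp
  also have "\<dots> = ?a powr (1 - ?s) * ?p powr (1 / real k * ?s)"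
    using p a by (simp add: powr_divide powr_powr powr_diff)
  also have "1 - ?s = 1 / real (Suc k)"
    by (simp add: field_simps)
  also have "1 / real k * ?s = 1 / real (Suc k)"
    using Suc.hyps by (simp add: field_simps)
  finally show ?case
    using p a by (simp add: powr_mult mult.commute)
qed

text \<open>The matrix recursion is the operator recursion transported along the isomorphism between matrices and operators
  of \<open>complex ^ 'n\<close>.\<close>

lemma matrix_gmean_eq:
  assumes "k \<ge> 1" and "\<forall>i\<in>{1..k}. op_of_matrix (A i) \<in> pos_invertible_ops"
  shows "matrix_gmean k A = matrix_of_op (op_gmean k (\<lambda>i. op_of_matrix (A i)))"
  using assms
proof (induction k arbitrary: A rule: nat_induct_at_least)
  case base
  then show ?case by (simp add: op_gmean_1 matrix_gmean_def matrix_of_op_of_matrix)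
next
  case (Suc k)
  let ?B = "op_of_matrix (A (Suc k))"
  have B: "?B \<in> pos_invertible_ops" using Suc.prems by simp
  have lin: "clinear_op T" if "T \<in> pos_invertible_ops" for T :: "(complex ^ 'n) \<Rightarrow>\<^sub>L (complex ^ 'n)"
    using that by (simp add: pos_invertible_iff self_adjointD)
  have pw: "matrix_powr M r = matrix_of_op (op_powr (op_of_matrix M) r)" for M :: "complex ^ 'n ^ 'n" and r
    by (simp add: matrix_powr_def matrix_of_op_def op_of_matrix_def)
  define S where "S = op_powr ?B (1/2)"
  define T where "T = op_powr ?B (- 1/2)"
  have ST: "S \<in> pos_invertible_ops" "T \<in> pos_invertible_ops"
    by (simp_all add: S_def T_def op_powr_pos_invertible B)
  define A' where "A' i = matrix_of_op T ** A i ** matrix_of_op T" for i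
  have A': "op_of_matrix (A' i) = T o\<^sub>L op_of_matrix (A i) o\<^sub>L T" for i
    by (simp add: A'_def op_of_matrix_mult op_of_matrix_of_op lin ST)
  have A'_pos: "\<forall>i\<in>{1..k}. op_of_matrix (A' i) \<in> pos_invertible_ops"
    using Suc.prems by (auto simp: A' intro!: sandwich_pos_invertible ST)
  let ?G = "op_gmean k (\<lambda>i. T o\<^sub>L op_of_matrix (A i) o\<^sub>L T)"
  have G: "?G \<in> pos_invertible_ops"
    using op_gmean_pos_invertible[OF Suc.hyps A'_pos] by (simp add: A')
  have IH: "matrix_gmean k A' = matrix_of_op ?G"
    using Suc.IH[OF A'_pos] by (simp add: A')
  have "matrix_gmean (Suc k) A
      = matrix_of_op S ** matrix_powr (matrix_gmean k A') (real k / real (k + 1)) ** matrix_of_op S"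
    using Suc.hyps by (simp add: matrix_gmean_def Let_def pw S_def T_def A'_def[abs_def])
  also have "\<dots> = matrix_of_op (S o\<^sub>L op_powr ?G (real k / real (k + 1)) o\<^sub>L S)"
    by (simp add: IH pw op_of_matrix_of_op matrix_of_op_compose lin ST G clinear_compose op_powr_pos_invertible
        del: of_nat_add of_nat_Suc)
  also have "\<dots> = matrix_of_op (op_gmean (Suc k) (\<lambda>i. op_of_matrix (A i)))"
    using Suc.hyps by (simp add: op_gmean_def Let_def S_def T_def)
  finally show ?case .
qed

lemma det_matrix_gmean:
  assumes k: "k \<ge> 1" and A: "\<forall>i\<in>{1..k}. matrix_pos_def (A i)"
  shows "det (matrix_gmean k A) = (\<Prod>i=1..k. det (A i)) powr (1 / of_nat k)"
proof -
  let ?T = "\<lambda>i. op_of_matrix (A i)"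
  have P: "\<forall>i\<in>{1..k}. ?T i \<in> pos_invertible_ops" using A matrix_pos_def_pos_invertible by blast
  have det: "det (A i) = complex_of_real (rdet (?T i))" if "i \<in> {1..k}" for i
    using op_det_eq_rdet[of "?T i"] P that by (simp add: op_det_def matrix_of_op_of_matrix)
  have "0 \<le> (\<Prod>i=1..k. rdet (?T i))"
    using P by (intro prod_nonneg) (auto intro!: less_imp_le rdet_pos)
  then have "complex_of_real ((\<Prod>i=1..k. rdet (?T i)) powr (1 / real k))
      = complex_of_real (\<Prod>i=1..k. rdet (?T i)) powr complex_of_real (1 / real k)"
    by (rule powr_of_real[symmetric])
  also have "complex_of_real (\<Prod>i=1..k. rdet (?T i)) = (\<Prod>i=1..k. det (A i))"
    using det by simp
  finally have "complex_of_real (rdet (op_gmean k ?T)) = (\<Prod>i=1..k. det (A i)) powr (1 / of_nat k)"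
    using rdet_op_gmean[OF k P] by simp
  moreover have "det (matrix_gmean k A) = complex_of_real (rdet (op_gmean k ?T))"
    unfolding matrix_gmean_eq[OF k P] op_det_def[symmetric]
    by (rule op_det_eq_rdet[OF op_gmean_pos_invertible[OF k P]])
  ultimately show ?thesis by simp
qed

theorem theorem4p2:
  fixes k :: nat
  assumes "infinite_dimensional TYPE('a :: complex_hilbert)"
    and "k \<ge> 1"
  shows
    "(\<forall>(A :: nat \<Rightarrow> 'a \<Rightarrow>\<^sub>L 'a) j B.
        (\<forall>i\<in>{1..k}. A i \<in> pos_invertible_ops) \<longrightarrow> j \<in> {1..k} \<longrightarrow>
        B \<in> pos_invertible_ops \<longrightarrow> A j \<le>\<^sub>L B \<longrightarrow>
        op_gmean k A \<le>\<^sub>L op_gmean k (A(j := B)))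
   \<and> (\<forall>(A :: nat \<Rightarrow> 'a \<Rightarrow>\<^sub>L 'a) C.
        (\<forall>i\<in>{1..k}. A i \<in> pos_invertible_ops) \<longrightarrow> op_invertible C \<longrightarrow>
        op_gmean k (\<lambda>i. op_adjoint C o\<^sub>L A i o\<^sub>L C) = op_adjoint C o\<^sub>L op_gmean k A o\<^sub>L C)
   \<and> (\<forall>(A :: nat \<Rightarrow> 'a \<Rightarrow>\<^sub>L 'a) (t :: nat \<Rightarrow> real).
        (\<forall>i\<in>{1..k}. A i \<in> pos_invertible_ops) \<longrightarrow> (\<forall>i\<in>{1..k}. t i > 0) \<longrightarrow>
        op_gmean k (\<lambda>i. t i *\<^sub>R A i) = ((\<Prod>i=1..k. t i) powr (1 / real k)) *\<^sub>R op_gmean k A)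
   \<and> (\<forall>A :: nat \<Rightarrow> 'a \<Rightarrow>\<^sub>L 'a.
        (\<forall>i\<in>{1..k}. A i \<in> pos_invertible_ops) \<longrightarrow>
        op_gmean k (\<lambda>i. op_inverse (A i)) = op_inverse (op_gmean k A))
   \<and> (\<forall>A :: nat \<Rightarrow> complex ^ 'n ^ 'n.
        (\<forall>i\<in>{1..k}. matrix_pos_def (A i)) \<longrightarrow>
        det (matrix_gmean k A) = (\<Prod>i=1..k. det (A i)) powr (1 / of_nat k))"
proof (intro conjI allI impI)
  fix A :: "nat \<Rightarrow> 'a \<Rightarrow>\<^sub>L 'a" and C :: "'a \<Rightarrow>\<^sub>L 'a"
  assume A: "\<forall>i\<in>{1..k}. A i \<in> pos_invertible_ops" and "op_invertible C"
  then obtain D where C: "clinear_op C" "is_inverse C D" by (auto simp: op_invertible_iff)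
  show "op_gmean k (\<lambda>i. op_adjoint C o\<^sub>L A i o\<^sub>L C) = op_adjoint C o\<^sub>L op_gmean k A o\<^sub>L C"
    by (rule op_gmean_congruence[OF assms(2) A C is_adjoint_op_adjoint[OF C(1)]])
qed (intro op_gmean_mono op_gmean_scaleR op_gmean_inverse det_matrix_gmean; use assms(2) in blast)+

end
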